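(* Let $(\Omega,\Sigma,\mu)$ be a finite measure space, let $E$ be a faithful solid subalgebra of $L^0(\Omega)$, and let $\mathcal U$ be a unital Banach--Kantorovich algebra over $E$ with unit $e$. For every $x\in\mathcal U$ the set $$\mathrm{spm}(x)=\{a\in E:\ \pi(ae-x)\notin\mathrm{Inv}(\pi\mathcal U)\ \text{for every idempotent } \pi\in E,\ \pi\ne0\}$$ is a nonempty, $(o)$-closed, cyclic and bounded subset of $E$.
   Context: **Base algebra.** $L^0(\Omega)$ is the algebra of a.e.-equivalence classes of complex measurable functions on $\Omega$, $L^\infty(\Omega)$ the subalgebra of classes of essentially bounded functions, $\mathbf 1$ the constant function $1$. A faithful solid subalgebra $E\subset L^0(\Omega)$ is a subalgebra such that $x\in L^0(\Omega)$, $y\in E$, $|x|\le|y|$ imply $x\in E$, and $E^\perp=\{0\}$ (only $0$ is disjoint from all of $E$); it is assumed that $L^\infty(\Omega)\subset E\subset L^0(\Omega)$. $\nabla$ denotes the Boolean algebra of all idempotents of $E$ (classes of indicator functions of measurable sets). **Banach--Kantorovich algebras.** An $E$-valued norm on a complex vector space $X$ is a map $\|\cdot\|:X\to E$ with $\|x\|\ge0$; $\|x\|=0\iff x=0$; $\|\lambda x\|=|\lambda|\|x\|$ for $\lambda\in\mathbb C$; $\|x+y\|\le\|x\|+\|y\|$. It is $d$-decomposable if, whenever $\|x\|=\lambda_1+\lambda_2$ with $0\le\lambda_1,\lambda_2\in E$, $\lambda_1\lambda_2=0$, there are $x_1,x_2$ with $x=x_1+x_2$, $\|x_k\|=\lambda_k$.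 A net $(x_\alpha)$ $(bo)$-converges to $x$ if $\|x-x_\alpha\|\to0$ in order. A Banach--Kantorovich space over $E$ is a space with a $d$-decomposable $E$-valued norm which is complete with respect to $(bo)$-convergence. A Banach--Kantorovich algebra over $E$ is a complex algebra $\mathcal U$ that is an $E$-module with $(au)v=a(uv)=u(av)$ ($a\in E$, $u,v\in\mathcal U$), with an $E$-valued norm making it a Banach--Kantorovich space over $E$, with $\|au\|=|a|\|u\|$ and $\|uv\|\le\|u\|\|v\|$. It is unital if it has a unit $e$ with $\|e\|=\mathbf 1$. **Spectral notation.** $\mathrm{Inv}(\cdot)$ is the set of invertible elements. For $0\ne\pi\in\nabla$, $\pi\mathcal U=\{\pi x:x\in\mathcal U\}$ is regarded as a unital algebra with unit $\pi e$. **Terms.** A set $S\subset E$ is $(o)$-closed if it contains the limits of its order-convergent sequences; cyclic if $\sum_n\pi_na_n\in S$ for every sequence $(a_n)\subset S$ and every partition of unity $(\pi_n)$ in $\nabla$ (pairwise disjoint idempotents with supremum $\mathbf 1$; the sum is the class equal to $a_n$ on the support of $\pi_n$); bounded if there is $c\in E$ with $|a|\le c$ for all $a\in S$. *)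

theory Defs
  imports "HOL-Analysis.Analysis" "HOL-Library.Complex_Order"
begin

section \<open>The algebra of classes of measurable functions\<close>

text \<open>
  An element of \<open>L0 M\<close> is an a.e.-equivalence class, represented as the set of all its
  measurable representatives.
\<close>

definition L0_class :: "'w measure \<Rightarrow> ('w \<Rightarrow> complex) \<Rightarrow> ('w \<Rightarrow> complex) set" where
  "L0_class M f = {g \<in> borel_measurable M. AE w in M. g w = f w}"

definition L0 :: "'w measure \<Rightarrow> ('w \<Rightarrow> complex) set set" where
  "L0 M = L0_class M ` borel_measurable M"

definition L_infty :: "'w measure \<Rightarrow> ('w \<Rightarrow> complex) set set" where
  "L_infty M = L0_class M ` {f \<in> borel_measurable M. \<exists>C. AE w in M. cmod (f w) \<le> C}"

text \<open>
  Pointwise operations on classes, without a choice of representatives; the lemmas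
  \<open>L0_lift1_class\<close> and \<open>L0_lift2_class\<close> below show that they are computed on any representatives.
\<close>

definition L0_lift1 ::
  "'w measure \<Rightarrow> (complex \<Rightarrow> complex) \<Rightarrow> ('w \<Rightarrow> complex) set \<Rightarrow> ('w \<Rightarrow> complex) set" where
  "L0_lift1 M \<phi> A = {h \<in> borel_measurable M. \<exists>f\<in>A. AE w in M. h w = \<phi> (f w)}"

definition L0_lift2 ::
  "'w measure \<Rightarrow> (complex \<Rightarrow> complex \<Rightarrow> complex) \<Rightarrow>
    ('w \<Rightarrow> complex) set \<Rightarrow> ('w \<Rightarrow> complex) set \<Rightarrow> ('w \<Rightarrow> complex) set" where
  "L0_lift2 M \<phi> A B =
    {h \<in> borel_measurable M. \<exists>f\<in>A. \<exists>g\<in>B. AE w in M. h w = \<phi> (f w) (g w)}"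

definition L0_const :: "'w measure \<Rightarrow> complex \<Rightarrow> ('w \<Rightarrow> complex) set" where
  "L0_const M c = L0_class M (\<lambda>_. c)"

abbreviation L0_zero :: "'w measure \<Rightarrow> ('w \<Rightarrow> complex) set" where
  "L0_zero M \<equiv> L0_const M 0"

abbreviation L0_one :: "'w measure \<Rightarrow> ('w \<Rightarrow> complex) set" where
  "L0_one M \<equiv> L0_const M 1"

definition L0_add where "L0_add M = L0_lift2 M (+)"
definition L0_diff where "L0_diff M = L0_lift2 M (-)"
definition L0_mult where "L0_mult M = L0_lift2 M (*)"
definition L0_abs where "L0_abs M = L0_lift1 M (\<lambda>z. complex_of_real (cmod z))"

text \<open>
  The order of \<open>complex\<close> is the one of \<open>Complex_Order\<close>: \<open>z \<le> w\<close> iff \<open>w - z\<close> is real and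
  nonnegative.  So \<open>0 \<le> A\<close> means that \<open>A\<close> is a.e. real and nonnegative.
\<close>

definition L0_le :: "'w measure \<Rightarrow> ('w \<Rightarrow> complex) set \<Rightarrow> ('w \<Rightarrow> complex) set \<Rightarrow> bool" where
  "L0_le M A B \<longleftrightarrow> (\<exists>f\<in>A. \<exists>g\<in>B. AE w in M. f w \<le> g w)"

text \<open>Disjointness in the sense of vector lattices: the infimum of the absolute values is zero.\<close>

definition L0_disjoint :: "'w measure \<Rightarrow> ('w \<Rightarrow> complex) set \<Rightarrow> ('w \<Rightarrow> complex) set \<Rightarrow> bool" where
  "L0_disjoint M A B \<longleftrightarrow>
    L0_lift2 M (\<lambda>z w. complex_of_real (min (cmod z) (cmod w))) A B = L0_zero M"

lemma L0_class_self: "f \<in> borel_measurable M \<Longrightarrow> f \<in> L0_class M f"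
  by (simp add: L0_class_def)

lemma L0_lift1_class:
  assumes "f \<in> borel_measurable M"
  shows "L0_lift1 M \<phi> (L0_class M f) = L0_class M (\<lambda>w. \<phi> (f w))"
proof (intro equalityI subsetI)
  fix h assume "h \<in> L0_lift1 M \<phi> (L0_class M f)"
  then obtain f' where "h \<in> borel_measurable M" "AE w in M. f' w = f w" "AE w in M. h w = \<phi> (f' w)"
    by (auto simp: L0_lift1_def L0_class_def)
  moreover from this(2,3) have "AE w in M. h w = \<phi> (f w)" by eventually_elim simp
  ultimately show "h \<in> L0_class M (\<lambda>w. \<phi> (f w))" by (simp add: L0_class_def)
next
  fix h assume "h \<in> L0_class M (\<lambda>w. \<phi> (f w))"
  then show "h \<in> L0_lift1 M \<phi> (L0_class M f)"
    using L0_class_self[OF assms] by (auto simp: L0_lift1_def L0_class_def)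
qed

lemma L0_lift2_class:
  assumes "f \<in> borel_measurable M" "g \<in> borel_measurable M"
  shows "L0_lift2 M \<phi> (L0_class M f) (L0_class M g) = L0_class M (\<lambda>w. \<phi> (f w) (g w))"
proof (intro equalityI subsetI)
  fix h assume "h \<in> L0_lift2 M \<phi> (L0_class M f) (L0_class M g)"
  then obtain f' g' where "h \<in> borel_measurable M" "AE w in M. f' w = f w" "AE w in M. g' w = g w"
      "AE w in M. h w = \<phi> (f' w) (g' w)"
    by (auto simp: L0_lift2_def L0_class_def)
  moreover from this(2-4) have "AE w in M. h w = \<phi> (f w) (g w)" by eventually_elim simp
  ultimately show "h \<in> L0_class M (\<lambda>w. \<phi> (f w) (g w))" by (simp add: L0_class_def)
next
  fix h assume "h \<in> L0_class M (\<lambda>w. \<phi> (f w) (g w))"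
  then show "h \<in> L0_lift2 M \<phi> (L0_class M f) (L0_class M g)"
    using L0_class_self[OF assms(1)] L0_class_self[OF assms(2)]
    by (auto simp: L0_lift2_def L0_class_def)
qed

lemma L0_le_class:
  assumes "f \<in> borel_measurable M" "g \<in> borel_measurable M"
  shows "L0_le M (L0_class M f) (L0_class M g) \<longleftrightarrow> (AE w in M. f w \<le> g w)"
proof
  assume "L0_le M (L0_class M f) (L0_class M g)"
  then obtain f' g' where "AE w in M. f' w = f w" "AE w in M. g' w = g w" "AE w in M. f' w \<le> g' w"
    by (auto simp: L0_le_def L0_class_def)
  then show "AE w in M. f w \<le> g w" by eventually_elim simp
next
  assume "AE w in M. f w \<le> g w"
  then show "L0_le M (L0_class M f) (L0_class M g)"
    using L0_class_self[OF assms(1)] L0_class_self[OF assms(2)] by (auto simp: L0_le_def)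
qed

section \<open>Order convergence\<close>

text \<open>
  \<open>f i \<rightarrow> l\<close> in order along the filter \<open>F\<close>: there is a net decreasing to zero in \<open>E\<close> (a nonempty
  downward directed set \<open>D\<close> with infimum zero), each member of which eventually dominates
  \<open>|f i - l|\<close>.  Order convergence of a net is the case where \<open>F\<close> is the filter generated by
  the tails of its index set.
\<close>

definition o_tendsto ::
  "'w measure \<Rightarrow> ('w \<Rightarrow> complex) set set \<Rightarrow> ('i \<Rightarrow> ('w \<Rightarrow> complex) set) \<Rightarrow>
    ('w \<Rightarrow> complex) set \<Rightarrow> 'i filter \<Rightarrow> bool" where
  "o_tendsto M E f l F \<longleftrightarrow>
    (\<exists>D\<subseteq>E. D \<noteq> {} \<and>
       (\<forall>d\<in>D. \<forall>d'\<in>D. \<exists>d''\<in>D. L0_le M d'' d \<and> L0_le M d'' d') \<and>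
       (\<forall>d\<in>D. L0_le M (L0_zero M) d) \<and>
       (\<forall>c\<in>E. (\<forall>d\<in>D. L0_le M c d) \<longrightarrow> L0_le M c (L0_zero M)) \<and>
       (\<forall>d\<in>D. \<forall>\<^sub>F i in F. L0_le M (L0_abs M (L0_diff M (f i) l)) d))"

section \<open>Faithful solid subalgebras\<close>

locale faithful_solid_subalgebra =
  fixes M :: "'w measure" and E :: "('w \<Rightarrow> complex) set set"
  assumes E_subset: "E \<subseteq> L0 M"
    and L_infty_subset: "L_infty M \<subseteq> E"
    and E_add: "\<And>a b. a \<in> E \<Longrightarrow> b \<in> E \<Longrightarrow> L0_add M a b \<in> E"
    and E_mult: "\<And>a b. a \<in> E \<Longrightarrow> b \<in> E \<Longrightarrow> L0_mult M a b \<in> E"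
    and E_scale: "\<And>l a. a \<in> E \<Longrightarrow> L0_mult M (L0_const M l) a \<in> E"
    and E_solid: "\<And>a b. a \<in> L0 M \<Longrightarrow> b \<in> E \<Longrightarrow> L0_le M (L0_abs M a) (L0_abs M b) \<Longrightarrow> a \<in> E"
    and E_faithful: "{a \<in> L0 M. \<forall>b\<in>E. L0_disjoint M a b} = {L0_zero M}"

definition idempotents :: "'w measure \<Rightarrow> ('w \<Rightarrow> complex) set set \<Rightarrow> ('w \<Rightarrow> complex) set set" where
  "idempotents M E = {p \<in> E. L0_mult M p p = p}"

section \<open>Banach--Kantorovich algebras\<close>

locale E_normed_space = faithful_solid_subalgebra M E + vector_space sc
  for M :: "'w measure" and E :: "('w \<Rightarrow> complex) set set"
    and sc :: "complex \<Rightarrow> 'u::ab_group_add \<Rightarrow> 'u" +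
  fixes nrm :: "'u \<Rightarrow> ('w \<Rightarrow> complex) set"
  assumes nrm_in: "\<And>u. nrm u \<in> E"
    and nrm_nonneg: "\<And>u. L0_le M (L0_zero M) (nrm u)"
    and nrm_zero_iff: "\<And>u. nrm u = L0_zero M \<longleftrightarrow> u = 0"
    and nrm_scale: "\<And>l u. nrm (sc l u) = L0_mult M (L0_const M (complex_of_real (cmod l))) (nrm u)"
    and nrm_triangle: "\<And>u v. L0_le M (nrm (u + v)) (L0_add M (nrm u) (nrm v))"

text \<open>
  Completeness is stated with proper filters instead of nets: the tails of a net generate a
  proper filter, every proper filter arises in this way, and both being \<open>(bo)\<close>-Cauchy and
  \<open>(bo)\<close>-converging depend on that filter only.
\<close>

locale Banach_Kantorovich_space = E_normed_space M E sc nrm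
  for M :: "'w measure" and E :: "('w \<Rightarrow> complex) set set"
    and sc :: "complex \<Rightarrow> 'u::ab_group_add \<Rightarrow> 'u" and nrm :: "'u \<Rightarrow> ('w \<Rightarrow> complex) set" +
  assumes d_decomposable: "\<And>u l1 l2. l1 \<in> E \<Longrightarrow> l2 \<in> E \<Longrightarrow>
      L0_le M (L0_zero M) l1 \<Longrightarrow> L0_le M (L0_zero M) l2 \<Longrightarrow> L0_mult M l1 l2 = L0_zero M \<Longrightarrow>
      nrm u = L0_add M l1 l2 \<Longrightarrow> \<exists>u1 u2. u = u1 + u2 \<and> nrm u1 = l1 \<and> nrm u2 = l2"
    and bo_complete: "\<And>F :: 'u filter. F \<noteq> bot \<Longrightarrow>
      o_tendsto M E (\<lambda>(u, v). nrm (u - v)) (L0_zero M) (F \<times>\<^sub>F F) \<Longrightarrow>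
      \<exists>u. o_tendsto M E (\<lambda>v. nrm (u - v)) (L0_zero M) F"

text \<open>
  The type class \<open>ring\<close> provides an associative multiplication that need not have a unit; \<open>sc\<close> is
  the multiplication by complex scalars and \<open>act\<close> the action of \<open>E\<close>.  Since \<open>E\<close> is a
  complex algebra, an \<open>E\<close>-module structure on a complex vector space includes
  \<open>(\<lambda> a) u = \<lambda> (a u)\<close> (\<open>act_scale\<close>).
\<close>

locale Banach_Kantorovich_algebra = Banach_Kantorovich_space M E sc nrm
  for M :: "'w measure" and E :: "('w \<Rightarrow> complex) set set"
    and sc :: "complex \<Rightarrow> 'u::ring \<Rightarrow> 'u" and nrm :: "'u \<Rightarrow> ('w \<Rightarrow> complex) set" +
  fixes act :: "('w \<Rightarrow> complex) set \<Rightarrow> 'u \<Rightarrow> 'u"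
  assumes sc_mult_left: "\<And>l u v. sc l (u * v) = sc l u * v"
    and sc_mult_right: "\<And>l u v. sc l (u * v) = u * sc l v"
    and act_add_right: "\<And>a u v. a \<in> E \<Longrightarrow> act a (u + v) = act a u + act a v"
    and act_add_left: "\<And>a b u. a \<in> E \<Longrightarrow> b \<in> E \<Longrightarrow> act (L0_add M a b) u = act a u + act b u"
    and act_mult: "\<And>a b u. a \<in> E \<Longrightarrow> b \<in> E \<Longrightarrow> act (L0_mult M a b) u = act a (act b u)"
    and act_one: "\<And>u. act (L0_one M) u = u"
    and act_scale: "\<And>l a u. a \<in> E \<Longrightarrow> act (L0_mult M (L0_const M l) a) u = sc l (act a u)"
    and act_mult_left: "\<And>a u v. a \<in> E \<Longrightarrow> act a u * v = act a (u * v)"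
    and act_mult_right: "\<And>a u v. a \<in> E \<Longrightarrow> act a (u * v) = u * act a v"
    and nrm_act: "\<And>a u. a \<in> E \<Longrightarrow> nrm (act a u) = L0_mult M (L0_abs M a) (nrm u)"
    and nrm_mult: "\<And>u v. L0_le M (nrm (u * v)) (L0_mult M (nrm u) (nrm v))"

locale unital_Banach_Kantorovich_algebra = Banach_Kantorovich_algebra M E sc nrm act
  for M :: "'w measure" and E :: "('w \<Rightarrow> complex) set set"
    and sc :: "complex \<Rightarrow> 'u::ring \<Rightarrow> 'u" and nrm :: "'u \<Rightarrow> ('w \<Rightarrow> complex) set"
    and act :: "('w \<Rightarrow> complex) set \<Rightarrow> 'u \<Rightarrow> 'u" +
  fixes e :: 'u
  assumes unit_left: "\<And>u. e * u = u"
    and unit_right: "\<And>u. u * e = u"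
    and nrm_unit: "nrm e = L0_one M"

section \<open>The spectrum\<close>

definition Inv :: "'u::ring set \<Rightarrow> 'u \<Rightarrow> 'u set" where
  "Inv A e = {u \<in> A. \<exists>v\<in>A. u * v = e \<and> v * u = e}"

definition spm ::
  "'w measure \<Rightarrow> ('w \<Rightarrow> complex) set set \<Rightarrow> (('w \<Rightarrow> complex) set \<Rightarrow> 'u \<Rightarrow> 'u) \<Rightarrow> 'u::ring \<Rightarrow>
    'u \<Rightarrow> ('w \<Rightarrow> complex) set set" where
  "spm M E act e x =
    {a \<in> E. \<forall>p \<in> idempotents M E. p \<noteq> L0_zero M \<longrightarrow>
       act p (act a e - x) \<notin> Inv (range (act p)) (act p e)}"

section \<open>Closed, cyclic and bounded sets\<close>

definition o_closed ::
  "'w measure \<Rightarrow> ('w \<Rightarrow> complex) set set \<Rightarrow> ('w \<Rightarrow> complex) set set \<Rightarrow> bool" where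
  "o_closed M E S \<longleftrightarrow>
    (\<forall>s l. (\<forall>n::nat. s n \<in> S) \<longrightarrow> l \<in> E \<longrightarrow> o_tendsto M E s l sequentially \<longrightarrow> l \<in> S)"

definition partition_of_unity ::
  "'w measure \<Rightarrow> ('w \<Rightarrow> complex) set set \<Rightarrow> (nat \<Rightarrow> ('w \<Rightarrow> complex) set) \<Rightarrow> bool" where
  "partition_of_unity M E p \<longleftrightarrow>
    (\<forall>n. p n \<in> idempotents M E) \<and>
    (\<forall>m n. m \<noteq> n \<longrightarrow> L0_mult M (p m) (p n) = L0_zero M) \<and>
    (\<forall>q \<in> idempotents M E. (\<forall>n. L0_le M (p n) q) \<longrightarrow> L0_le M (L0_one M) q)"

text \<open>
  The sum of the \<open>p n a n\<close> is the unique class \<open>b\<close> in \<open>L0 M\<close> that agrees with \<open>a n\<close> on the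
  support of \<open>p n\<close> for all \<open>n\<close>.
\<close>

definition is_mixing ::
  "'w measure \<Rightarrow> (nat \<Rightarrow> ('w \<Rightarrow> complex) set) \<Rightarrow> (nat \<Rightarrow> ('w \<Rightarrow> complex) set) \<Rightarrow>
    ('w \<Rightarrow> complex) set \<Rightarrow> bool" where
  "is_mixing M p a b \<longleftrightarrow> b \<in> L0 M \<and> (\<forall>n. L0_mult M (p n) b = L0_mult M (p n) (a n))"

definition cyclic ::
  "'w measure \<Rightarrow> ('w \<Rightarrow> complex) set set \<Rightarrow> ('w \<Rightarrow> complex) set set \<Rightarrow> bool" where
  "cyclic M E S \<longleftrightarrow>
    (\<forall>p a. partition_of_unity M E p \<longrightarrow> (\<forall>n. a n \<in> S) \<longrightarrow> (\<exists>b\<in>S. is_mixing M p a b))"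

definition o_bounded ::
  "'w measure \<Rightarrow> ('w \<Rightarrow> complex) set set \<Rightarrow> ('w \<Rightarrow> complex) set set \<Rightarrow> bool" where
  "o_bounded M E S \<longleftrightarrow> (\<exists>c\<in>E. \<forall>a\<in>S. L0_le M (L0_abs M a) c)"

end

theory Submission
  imports Defs
begin

text \<open>
  Boundedness and closedness are Neumann series arguments on a set of positive measure on which
  all the functions involved are bounded, and cyclicity holds because invertibility is inherited
  by smaller idempotents.

  For nonemptiness one may divide \<open>x\<close> by \<open>1 + \<parallel>x\<parallel>\<close> and so assume \<open>\<parallel>x\<parallel> \<le> 1\<close>.  For a set \<open>S\<close> of
  positive measure, the elements of the algebra that live on \<open>S\<close> and have an essentially bounded
  norm form an ordinary normed algebra, in which \<open>x\<close> has a spectral value; so on no such \<open>S\<close> does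
  every scalar \<open>\<xi>\<close> with \<open>\<bar>\<xi>\<bar> \<le> 2\<close> admit a bounded inverse of \<open>\<xi> e - x\<close>.  If a disc has this
  property on every part of \<open>S\<close>, then \<open>S\<close> splits into finitely many pieces on each of which the same is
  true of one of finitely many discs of half the radius that cover it.  The centres of the nested
  discs chosen in this way are simple functions that converge uniformly to an element of the
  spectrum.
\<close>

text \<open>Non-invertibility of \<open>sc \<xi> e - x\<close> on \<open>S\<close> for a single
  scalar is too weak: \<open>spm\<close> demands it on every nonnull part of \<open>S\<close>, and
  the parts on which an inverse exists vary with uncountably many \<xi>. This is why discs are used,
  with a property that all nonnull parts share. Finiteness of the covers lets the property pass to
  smaller discs, since finitely many successive shrinkings keep a set nonnull. Boundedness of the
  inverses serves two ends. It places them in the normed algebra of bounded elements, and an inverse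
  with bound C survives all scalar perturbations up to 1/(2C), so that an inverse at the limit would
  yield bounded inverses on a whole disc around it. An arbitrary inverse becomes bounded after
  shrinking \<open>S\<close>, because its norm is a finite measurable function. The radius 2 leaves
  room beyond \<parallel>x\<parallel> \<le> 1 for a Neumann series of ratio 1/2 outside the
  disc.\<close>

section \<open>The spectrum in a normed algebra\<close>

text \<open>The algebra is a subset of the type with a unit of its own, so that the locale fits the
  corner cut out by an idempotent, whose unit is \<open>res S e\<close>.\<close>

locale normed_algebra_on = vector_space sc
  for sc :: "complex \<Rightarrow> 'u::ring \<Rightarrow> 'u" +
  fixes A :: "'u set" and N :: "'u \<Rightarrow> real" and e :: 'u
  assumes scale_mult_left: "sc l u * v = sc l (u * v)"
    and scale_mult_right: "u * sc l v = sc l (u * v)"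
    and unit_in: "e \<in> A"
    and add_in: "u \<in> A \<Longrightarrow> v \<in> A \<Longrightarrow> u + v \<in> A"
    and scale_in: "u \<in> A \<Longrightarrow> sc l u \<in> A"
    and mult_in: "u \<in> A \<Longrightarrow> v \<in> A \<Longrightarrow> u * v \<in> A"
    and mult_unit_left: "u \<in> A \<Longrightarrow> e * u = u"
    and mult_unit_right: "u \<in> A \<Longrightarrow> u * e = u"
    and N_nonneg: "u \<in> A \<Longrightarrow> 0 \<le> N u"
    and N_unit: "N e = 1"
    and N_add: "u \<in> A \<Longrightarrow> v \<in> A \<Longrightarrow> N (u + v) \<le> N u + N v"
    and N_scale: "u \<in> A \<Longrightarrow> N (sc l u) \<le> cmod l * N u"
    and N_mult: "u \<in> A \<Longrightarrow> v \<in> A \<Longrightarrow> N (u * v) \<le> N u * N v"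
begin

lemma uminus_in: "u \<in> A \<Longrightarrow> - u \<in> A"
  using scale_in[of u "-1"] by simp

lemma diff_in: "u \<in> A \<Longrightarrow> v \<in> A \<Longrightarrow> u - v \<in> A"
  using add_in[of u "- v"] uminus_in by simp

lemma N_uminus: "u \<in> A \<Longrightarrow> N (- u) \<le> N u"
  using N_scale[of u "-1"] by simp

lemma N_diff: "u \<in> A \<Longrightarrow> v \<in> A \<Longrightarrow> N (u - v) \<le> N u + N v"
  using N_add[of u "- v"] N_uminus[of v] uminus_in by fastforce

text \<open>This is x^(2^m). Doubling the exponent matches the splitting of the 2^(m+1)-th roots of
  unity into two cosets of the 2^m-th roots.\<close>

primrec iterated_square :: "'u \<Rightarrow> nat \<Rightarrow> 'u" where
  "iterated_square x 0 = x"
| "iterated_square x (Suc m) = iterated_square x m * iterated_square x m"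

text \<open>
  The average of \<open>\<xi> R \<xi>\<close> over the rotations of \<open>\<xi>\<close> by the \<open>2 ^ m\<close>-th roots of unity.
\<close>

primrec root_average :: "(complex \<Rightarrow> 'u) \<Rightarrow> nat \<Rightarrow> complex \<Rightarrow> 'u" where
  "root_average R 0 \<xi> = sc \<xi> (R \<xi>)"
| "root_average R (Suc m) \<xi> =
    sc (1/2) (root_average R m \<xi> + root_average R m (\<xi> * cis (pi / 2 ^ m)))"

lemma iterated_square_in: "x \<in> A \<Longrightarrow> iterated_square x m \<in> A"
  by (induction m) (auto intro: mult_in)

lemma root_average_in: "(\<And>\<xi>. R \<xi> \<in> A) \<Longrightarrow> root_average R m \<xi> \<in> A"
  by (induction m arbitrary: \<xi>) (auto intro: scale_in add_in)

text \<open>Rotation by \<open>cis (pi / 2 ^ m)\<close> changes the sign of a = \<xi>^(2^m). With y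
  = x^(2^m), both a - y and -a - y divide a^2 - y^2, and the two cofactors contribute a(a + y) +
  (-a)(-a + y) = 2 a^2.\<close>

lemma root_average_mult:
  assumes "x \<in> A" "\<And>\<xi>. R \<xi> \<in> A" "\<And>\<xi>. R \<xi> * (sc \<xi> e - x) = e"
  shows "root_average R m \<xi> * (sc (\<xi> ^ 2 ^ m) e - iterated_square x m) = sc (\<xi> ^ 2 ^ m) e"
proof (induction m arbitrary: \<xi>)
  case 0
  show ?case using assms by (simp add: scale_mult_left)
next
  case (Suc m)
  define y where "y = iterated_square x m"
  define a where "a = \<xi> ^ 2 ^ m"
  define h1 where "h1 = root_average R m \<xi>"
  define h2 where "h2 = root_average R m (\<xi> * cis (pi / 2 ^ m))"
  have y: "y \<in> A" using iterated_square_in assms(1) by (simp add: y_def)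
  have "cis (pi / 2 ^ m) ^ 2 ^ m = -1"
    by (subst Complex.DeMoivre) simp
  then have a': "(\<xi> * cis (pi / 2 ^ m)) ^ 2 ^ m = - a"
    by (simp add: power_mult_distrib a_def)
  have 1: "h1 * (sc a e - y) = sc a e"
    using Suc[of \<xi>] by (simp add: h1_def y_def a_def)
  have 2: "h2 * (sc (-a) e - y) = sc (-a) e"
    using Suc[of "\<xi> * cis (pi / 2 ^ m)"] a' by (simp add: h2_def y_def)
  have f1: "sc (a * a) e - y * y = (sc a e - y) * (sc a e + y)"
    using y unit_in by (simp add: algebra_simps scale_mult_left scale_mult_right
        mult_unit_left mult_unit_right scale_in)
  have f2: "sc (a * a) e - y * y = (sc (-a) e - y) * (sc (-a) e + y)"
    using y unit_in by (simp add: algebra_simps scale_mult_left scale_mult_right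
        mult_unit_left mult_unit_right scale_in)
  have "h1 * (sc (a * a) e - y * y) = sc a e * (sc a e + y)"
    unfolding f1 mult.assoc[symmetric] 1 ..
  moreover have "h2 * (sc (a * a) e - y * y) = sc (-a) e * (sc (-a) e + y)"
    unfolding f2 mult.assoc[symmetric] 2 ..
  ultimately have "(h1 + h2) * (sc (a * a) e - y * y) =
      sc a e * (sc a e + y) + sc (-a) e * (sc (-a) e + y)"
    by (simp add: distrib_right)
  also have "\<dots> = sc (a * a) e + sc (a * a) e"
    using y unit_in by (simp add: distrib_left right_diff_distrib scale_mult_left
        scale_mult_right mult_unit_left scale_right_diff_distrib)
  also have "\<dots> = sc (2 * (a * a)) e"
    by (simp flip: scale_left_distrib)
  finally have "(h1 + h2) * (sc (a * a) e - y * y) = sc (2 * (a * a)) e" .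
  moreover have "\<xi> ^ 2 ^ Suc m = a * a"
    by (simp add: a_def mult_2 power_add)
  ultimately show ?case
    by (simp add: scale_mult_left flip: h1_def h2_def y_def)
qed

lemma root_average_bound:
  assumes "\<And>\<xi>. R \<xi> \<in> A" "\<And>\<xi>. N (R \<xi>) \<le> C"
  shows "N (root_average R m \<xi>) \<le> C * cmod \<xi>"
proof (induction m arbitrary: \<xi>)
  case 0
  show ?case using N_scale[OF assms(1), of \<xi> \<xi>] mult_left_mono[OF assms(2), of "cmod \<xi>" \<xi>]
    by (simp add: mult.commute)
next
  case (Suc m)
  let ?h = "root_average R m \<xi>" and ?k = "root_average R m (\<xi> * cis (pi / 2 ^ m))"
  have "N (sc (1/2) (?h + ?k)) \<le> 1/2 * N (?h + ?k)"
    using N_scale[of "?h + ?k" "1/2"] assms by (auto intro: add_in root_average_in simp: norm_divide)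
  moreover have "N (?h + ?k) \<le> N ?h + N ?k"
    using assms by (auto intro: N_add root_average_in)
  ultimately show ?case using Suc[of \<xi>] Suc[of "\<xi> * cis (pi / 2 ^ m)"]
    by (simp add: norm_mult)
qed

text \<open>Rotations preserve distances and averaging does not increase a Lipschitz constant, so
  \<open>L\<close> serves for all \<open>m\<close> at once; this is the equicontinuity used
  below.\<close>

lemma root_average_Lipschitz:
  assumes "\<And>\<xi>. R \<xi> \<in> A" "\<And>\<xi> \<mu>. N (sc \<xi> (R \<xi>) - sc \<mu> (R \<mu>)) \<le> L * cmod (\<xi> - \<mu>)"
  shows "N (root_average R m \<xi> - root_average R m \<mu>) \<le> L * cmod (\<xi> - \<mu>)"
proof (induction m arbitrary: \<xi> \<mu>)
  case 0
  show ?case using assms by simp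
next
  case (Suc m)
  let ?z = "cis (pi / 2 ^ m)"
  let ?h = "root_average R m \<xi> - root_average R m \<mu>"
    and ?k = "root_average R m (\<xi> * ?z) - root_average R m (\<mu> * ?z)"
  have in_A: "?h \<in> A" "?k \<in> A" using assms by (auto intro: diff_in root_average_in)
  have "N (sc (1/2) (?h + ?k)) \<le> 1/2 * N (?h + ?k)"
    using N_scale[of "?h + ?k" "1/2"] in_A by (auto intro: add_in simp: norm_divide)
  moreover have "N (?h + ?k) \<le> N ?h + N ?k"
    using in_A by (rule N_add)
  moreover have "cmod (\<xi> * ?z - \<mu> * ?z) = cmod (\<xi> - \<mu>)"
    by (simp add: norm_mult flip: left_diff_distrib)
  moreover have "root_average R (Suc m) \<xi> - root_average R (Suc m) \<mu> = sc (1/2) (?h + ?k)"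
    by (simp add: scale_right_distrib scale_right_diff_distrib)
  ultimately show ?case using Suc[of \<xi> \<mu>] Suc[of "\<xi> * ?z" "\<mu> * ?z"]
    by simp
qed

text \<open>The resolvent identity makes N (R \<xi>) continuous, hence bounded on a compact disc;
  outside it, \<xi> R \<xi> = e + x R \<xi> gives a bound. The identity then turns the global bound
  into the Lipschitz estimate.\<close>

lemma resolvent_bounded:
  assumes x: "x \<in> A" and R: "\<And>\<xi>. R \<xi> \<in> A"
    and left: "\<And>\<xi>. R \<xi> * (sc \<xi> e - x) = e" and right: "\<And>\<xi>. (sc \<xi> e - x) * R \<xi> = e"
  obtains C where "\<And>\<xi>. N (R \<xi>) \<le> C" "\<And>\<xi> \<mu>. N (R \<xi> - R \<mu>) \<le> C * C * cmod (\<xi> - \<mu>)"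
proof -
  have resolvent: "R \<xi> - R \<mu> = sc (\<mu> - \<xi>) (R \<xi> * R \<mu>)" for \<xi> \<mu>
  proof -
    have "R \<xi> - R \<mu> = R \<xi> * ((sc \<mu> e - x) * R \<mu>) - (R \<xi> * (sc \<xi> e - x)) * R \<mu>"
      using R left right by (simp add: mult_unit_left mult_unit_right)
    also have "\<dots> = sc (\<mu> - \<xi>) (R \<xi> * R \<mu>)"
      using R by (simp add: algebra_simps scale_mult_left scale_mult_right mult_unit_left mult_unit_right)
    finally show ?thesis .
  qed
  have diff_le: "N (R \<xi> - R \<mu>) \<le> cmod (\<xi> - \<mu>) * (N (R \<xi>) * N (R \<mu>))" for \<xi> \<mu>
  proof -
    have "N (sc (\<mu> - \<xi>) (R \<xi> * R \<mu>)) \<le> cmod (\<mu> - \<xi>) * N (R \<xi> * R \<mu>)"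
      using R by (intro N_scale mult_in)
    also have "\<dots> \<le> cmod (\<mu> - \<xi>) * (N (R \<xi>) * N (R \<mu>))"
      using R by (intro mult_left_mono N_mult) auto
    finally show ?thesis by (simp add: resolvent norm_minus_commute)
  qed
  have dist: "\<bar>N (R \<xi>) - N (R \<mu>)\<bar> \<le> N (R \<xi> - R \<mu>)" for \<xi> \<mu>
  proof -
    have "N (R \<xi>) \<le> N (R \<xi> - R \<mu>) + N (R \<mu>)"
      using N_add[of "R \<xi> - R \<mu>" "R \<mu>"] R diff_in by simp
    moreover have "N (R \<mu>) \<le> N (R \<xi>) + N (R \<xi> - R \<mu>)"
      using N_diff[of "R \<xi>" "R \<xi> - R \<mu>"] R diff_in by simp
    ultimately show ?thesis by linarith
  qed
  \<comment> \<open>The right-hand side of \<open>diff_le\<close> still contains the unknown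
    \<open>N (R \<mu>)\<close>; close to \<xi> it is absorbed at the cost of a factor 2.\<close>
  have locally: "N (R \<mu>) \<le> 2 * N (R \<xi>)" if "cmod (\<xi> - \<mu>) * N (R \<xi>) \<le> 1/2" for \<xi> \<mu>
  proof -
    have "N (R \<mu>) - N (R \<xi>) \<le> (cmod (\<xi> - \<mu>) * N (R \<xi>)) * N (R \<mu>)"
      using dist[of \<xi> \<mu>] diff_le[of \<xi> \<mu>] by (simp add: mult.assoc)
    also have "\<dots> \<le> 1/2 * N (R \<mu>)"
      using that R N_nonneg by (intro mult_right_mono) auto
    finally show ?thesis by simp
  qed
  have cont: "continuous_on UNIV (\<lambda>\<xi>. N (R \<xi>))"
  proof (rule continuous_at_imp_continuous_on, rule ballI)
    fix \<xi>
    let ?n = "N (R \<xi>)"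
    have n: "?n \<ge> 0" using N_nonneg R by simp
    have ev: "eventually (\<lambda>\<mu>. cmod (\<xi> - \<mu>) * ?n \<le> 1/2) (at \<xi>)"
    proof -
      have "((\<lambda>\<mu>. cmod (\<xi> - \<mu>) * ?n) \<longlongrightarrow> cmod (\<xi> - \<xi>) * ?n) (at \<xi>)"
        by (intro tendsto_intros)
      then have "eventually (\<lambda>\<mu>. cmod (\<xi> - \<mu>) * ?n < 1/2) (at \<xi>)"
        by (rule order_tendstoD) simp
      then show ?thesis by eventually_elim simp
    qed
    have "((\<lambda>\<mu>. N (R \<mu>) - N (R \<xi>)) \<longlongrightarrow> 0) (at \<xi>)"
    proof (rule Lim_null_comparison)
      show "eventually (\<lambda>\<mu>. norm (N (R \<mu>) - N (R \<xi>)) \<le> cmod (\<xi> - \<mu>) * (?n * (2 * ?n))) (at \<xi>)"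
        using ev
      proof eventually_elim
        case (elim \<mu>)
        have "norm (N (R \<mu>) - N (R \<xi>)) \<le> cmod (\<xi> - \<mu>) * (?n * N (R \<mu>))"
          using dist[of \<xi> \<mu>] diff_le[of \<xi> \<mu>] by (simp add: abs_minus_commute)
        also have "\<dots> \<le> cmod (\<xi> - \<mu>) * (?n * (2 * ?n))"
          using locally[OF elim] n by (intro mult_left_mono) auto
        finally show ?case .
      qed
      have "((\<lambda>\<mu>. cmod (\<xi> - \<mu>) * (?n * (2 * ?n))) \<longlongrightarrow> cmod (\<xi> - \<xi>) * (?n * (2 * ?n))) (at \<xi>)"
        by (intro tendsto_intros)
      then show "((\<lambda>\<mu>. cmod (\<xi> - \<mu>) * (?n * (2 * ?n))) \<longlongrightarrow> 0) (at \<xi>)" by simp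
    qed
    then show "isCont (\<lambda>\<xi>. N (R \<xi>)) \<xi>"
      unfolding isCont_def by (simp add: LIM_zero_iff)
  qed
  have "bounded ((\<lambda>\<xi>. N (R \<xi>)) ` cball 0 (N x + 1))"
    by (intro compact_imp_bounded compact_continuous_image continuous_on_subset[OF cont]) auto
  then obtain B where B: "\<And>\<xi>. cmod \<xi> \<le> N x + 1 \<Longrightarrow> N (R \<xi>) \<le> B"
    by (fastforce simp: bounded_iff abs_le_iff)
  \<comment> \<open>From N (R \<xi>) |\<xi>| \<le> 1 + N x N (R \<xi>), a modulus exceeding N x by
    at least 1 forces the bound 1.\<close>
  have far: "N (R \<xi>) \<le> 1" if "cmod \<xi> \<ge> N x + 1" for \<xi>
  proof -
    have \<xi>: "\<xi> \<noteq> 0" using that N_nonneg[OF x] by auto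
    have "R \<xi> = sc (1 / \<xi>) (sc \<xi> (R \<xi>))" using \<xi> by simp
    also have "sc \<xi> (R \<xi>) = e + x * R \<xi>"
      using right[of \<xi>] R by (simp add: algebra_simps scale_mult_left mult_unit_left)
    finally have "N (R \<xi>) \<le> cmod (1 / \<xi>) * N (e + x * R \<xi>)"
      using N_scale[of "e + x * R \<xi>" "1 / \<xi>"] R x unit_in by (auto intro: add_in mult_in)
    also have "\<dots> \<le> cmod (1 / \<xi>) * (1 + N x * N (R \<xi>))"
      using N_add[OF unit_in mult_in[OF x R]] N_mult[OF x R, of \<xi>] N_unit
      by (intro mult_left_mono) (smt (verit), simp)
    finally have "N (R \<xi>) * cmod \<xi> \<le> 1 + N x * N (R \<xi>)"
      using \<xi> by (simp add: norm_divide field_simps)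
    moreover have "N (R \<xi>) * (N x + 1) \<le> N (R \<xi>) * cmod \<xi>"
      using that R N_nonneg by (intro mult_left_mono) auto
    ultimately show ?thesis by (simp add: algebra_simps)
  qed
  define C where "C = max B 1"
  have C: "N (R \<xi>) \<le> C" for \<xi>
    using B[of \<xi>] far[of \<xi>] by (cases "cmod \<xi> \<le> N x + 1") (auto simp: C_def)
  have "N (R \<xi> - R \<mu>) \<le> C * C * cmod (\<xi> - \<mu>)" for \<xi> \<mu>
  proof -
    have "N (R \<xi>) * N (R \<mu>) \<le> C * C"
      using C R N_nonneg by (intro mult_mono) (auto simp: C_def)
    then have "cmod (\<xi> - \<mu>) * (N (R \<xi>) * N (R \<mu>)) \<le> cmod (\<xi> - \<mu>) * (C * C)"
      by (intro mult_left_mono) auto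
    then show ?thesis using diff_le[of \<xi> \<mu>] by (simp add: mult.commute)
  qed
  with C show thesis by (rule that)
qed

text \<open>Squaring the element squares the ratio q = N (x^(2^m)) / t^(2^m), so one ratio below 1
  yields arbitrarily small ones.\<close>

lemma iterated_square_small:
  assumes x: "x \<in> A" and t: "t > 0" and m: "N (iterated_square x m) < t ^ 2 ^ m" and \<epsilon>: "\<epsilon> > 0"
  shows "\<exists>k. N (iterated_square x k) < \<epsilon> * t ^ 2 ^ k"
proof -
  define q where "q = N (iterated_square x m) / t ^ 2 ^ m"
  have q: "0 \<le> q" "q < 1"
    using m t N_nonneg[OF iterated_square_in[OF x]] by (auto simp: q_def)
  have le: "N (iterated_square x (m + i)) \<le> q ^ 2 ^ i * t ^ 2 ^ (m + i)" for i
  proof (induction i)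
    case 0
    show ?case using t by (simp add: q_def)
  next
    case (Suc i)
    let ?y = "iterated_square x (m + i)"
    have "N (?y * ?y) \<le> N ?y * N ?y"
      using iterated_square_in[OF x] by (intro N_mult)
    also have "\<dots> \<le> (q ^ 2 ^ i * t ^ 2 ^ (m + i)) * (q ^ 2 ^ i * t ^ 2 ^ (m + i))"
      using Suc N_nonneg[OF iterated_square_in[OF x]] q t by (intro mult_mono) auto
    finally show ?case by (simp add: power2_eq_square power_mult power_mult_distrib mult.commute mult.left_commute)
  qed
  obtain i where i: "q ^ i < \<epsilon>" using real_arch_pow_inv[OF \<epsilon> q(2)] by blast
  have "q ^ 2 ^ i \<le> q ^ i" using q by (intro power_decreasing) (auto simp: less_imp_le)
  with i have "q ^ 2 ^ i * t ^ 2 ^ (m + i) < \<epsilon> * t ^ 2 ^ (m + i)"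
    using t by (intro mult_strict_right_mono) auto
  with le[of i] show ?thesis by (intro exI[of _ "m + i"]) simp
qed

text \<open>
  Rickart's elementary argument, which needs neither contour integrals nor functionals: the
  averages of \<open>\<xi> R \<xi>\<close> equal \<open>(1 - (x / \<xi>) ^ 2 ^ m)\<inverse>\<close> and are equicontinuous in \<open>\<xi>\<close>, so that the
  set of radii \<open>t\<close> for which the powers of \<open>x / t\<close> become small can be shrunk by steps of a fixed
  size, down to radii where the averages themselves are small.
\<close>

theorem spectrum_nonempty:
  assumes x: "x \<in> A"
  shows "\<exists>\<xi>. \<not> (\<exists>v\<in>A. v * (sc \<xi> e - x) = e \<and> (sc \<xi> e - x) * v = e)"
proof (rule ccontr)
  assume "\<not> ?thesis"
  then have "\<forall>\<xi>. \<exists>v. v \<in> A \<and> v * (sc \<xi> e - x) = e \<and> (sc \<xi> e - x) * v = e" by blast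
  then obtain R where R: "\<And>\<xi>. R \<xi> \<in> A" and left: "\<And>\<xi>. R \<xi> * (sc \<xi> e - x) = e"
    and right: "\<And>\<xi>. (sc \<xi> e - x) * R \<xi> = e"
    by metis
  obtain C where C: "\<And>\<xi>. N (R \<xi>) \<le> C"
    and CC: "\<And>\<xi> \<mu>. N (R \<xi> - R \<mu>) \<le> C * C * cmod (\<xi> - \<mu>)"
    using resolvent_bounded[OF x R left right] by blast
  have C0: "C \<ge> 0" using C[of 0] N_nonneg[OF R, of 0] by linarith
  \<comment> \<open>Since \<xi> R \<xi> = e + x R \<xi>, differences of \<xi> R \<xi> are x times
    differences of the resolvent.\<close>
  define L where "L = N x * (C * C)"
  have L0: "L \<ge> 0" using N_nonneg[OF x] by (simp add: L_def)
  have Lip: "N (sc \<xi> (R \<xi>) - sc \<mu> (R \<mu>)) \<le> L * cmod (\<xi> - \<mu>)" for \<xi> \<mu>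
  proof -
    have f: "sc \<xi> (R \<xi>) = e + x * R \<xi>" for \<xi>
      using right[of \<xi>] R by (simp add: algebra_simps scale_mult_left mult_unit_left)
    have "N (sc \<xi> (R \<xi>) - sc \<mu> (R \<mu>)) = N (x * (R \<xi> - R \<mu>))"
      by (simp add: f algebra_simps)
    also have "\<dots> \<le> N x * N (R \<xi> - R \<mu>)"
      using x R by (intro N_mult diff_in)
    also have "\<dots> \<le> N x * (C * C * cmod (\<xi> - \<mu>))"
      using CC N_nonneg[OF x] by (intro mult_left_mono)
    finally show ?thesis by (simp add: L_def mult.assoc)
  qed
  let ?h = "root_average R" and ?y = "iterated_square x"
  have h_in: "?h m \<xi> \<in> A" for m \<xi> using R by (rule root_average_in)
  have y_in: "?y m \<in> A" for m using x by (rule iterated_square_in)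
  have h_mult: "?h m \<xi> * (sc (\<xi> ^ 2 ^ m) e - ?y m) = sc (\<xi> ^ 2 ^ m) e" for m \<xi>
    using x R left by (rule root_average_mult)
  define T where "T = {t. t > 0 \<and> (\<exists>m. N (?y m) < t ^ 2 ^ m)}"
  \<comment> \<open>With a = t^(2^k) one has a (h - e) = h x^(2^k) and N h \<le> C t. Hence x^(2^k)
    is made small relative to \<epsilon> / (C t + 1), where the 1 guards against C = 0.\<close>
  have near_unit: "\<exists>m. N (?h m (of_real t) - e) < \<epsilon>" if tT: "t \<in> T" and \<epsilon>: "\<epsilon> > 0" for t \<epsilon>
  proof -
    have t: "t > 0" using tT by (simp add: T_def)
    obtain k where k: "N (?y k) < \<epsilon> / (C * t + 1) * t ^ 2 ^ k"
      using tT iterated_square_small[OF x, of t _ "\<epsilon> / (C * t + 1)"] \<epsilon> C0 t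
      by (auto simp: T_def add_nonneg_pos)
    let ?a = "complex_of_real t ^ 2 ^ k"
    have a: "cmod ?a = t ^ 2 ^ k" using t by (simp add: norm_power)
    have a0: "?a \<noteq> 0" using t by simp
    have "?h k t - e = sc (1 / ?a) (sc ?a (?h k t - e))" using a0 by simp
    also have "sc ?a (?h k t - e) = ?h k t * ?y k"
      using h_mult[of k "of_real t"] h_in[of k "of_real t"]
      by (simp add: algebra_simps scale_mult_left scale_mult_right mult_unit_right)
    finally have "N (?h k t - e) \<le> cmod (1 / ?a) * N (?h k t * ?y k)"
      using N_scale[of "?h k t * ?y k" "1 / ?a"] h_in y_in by (auto intro: mult_in)
    also have "\<dots> \<le> cmod (1 / ?a) * (C * t * N (?y k))"
    proof (rule mult_left_mono)
      have "N (?h k t * ?y k) \<le> N (?h k t) * N (?y k)" using h_in y_in by (intro N_mult)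
      also have "\<dots> \<le> C * t * N (?y k)"
        using root_average_bound[of R C k "of_real t"] R C t N_nonneg[OF y_in]
        by (intro mult_right_mono) auto
      finally show "N (?h k t * ?y k) \<le> C * t * N (?y k)" .
    qed simp
    also have "\<dots> = C * t * N (?y k) / t ^ 2 ^ k" using t by (simp add: norm_divide norm_power)
    also have "\<dots> \<le> (C * t + 1) * N (?y k) / t ^ 2 ^ k"
      using t N_nonneg[OF y_in] by (intro divide_right_mono mult_right_mono) auto
    also have "\<dots> < (C * t + 1) * (\<epsilon> / (C * t + 1) * t ^ 2 ^ k) / t ^ 2 ^ k"
      using k t C0 by (intro divide_strict_right_mono mult_strict_left_mono) (auto simp: add_nonneg_pos)
    also have "\<dots> = \<epsilon>" using t C0
      by (smt (verit) nonzero_mult_div_cancel_right times_divide_eq_right nonzero_mult_div_cancel_left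
          mult_nonneg_nonneg zero_less_power)
    finally show ?thesis ..
  qed
  \<comment> \<open>The converse direction: d = h - e satisfies x^(2^m) = a d - d x^(2^m) with a =
    s^(2^m), and N d < 1/2 lets the last term be absorbed.\<close>
  have in_T: "s \<in> T" if s: "s > 0" and h: "N (?h m (of_real s) - e) < 1/2" for s m
  proof -
    let ?a = "complex_of_real s ^ 2 ^ m" and ?d = "?h m s - e"
    have a: "cmod ?a = s ^ 2 ^ m" using s by (simp add: norm_power)
    have d: "?d \<in> A" using h_in unit_in by (intro diff_in)
    have "?y m = sc ?a ?d - ?d * ?y m"
      using h_mult[of m "of_real s"] h_in[of m "of_real s"] y_in unit_in
      by (simp add: algebra_simps scale_mult_left scale_mult_right mult_unit_right mult_unit_left)
    then have "N (?y m) \<le> N (sc ?a ?d) + N (?d * ?y m)"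
      using N_diff[of "sc ?a ?d" "?d * ?y m"] d y_in by (auto intro: scale_in mult_in)
    also have "\<dots> \<le> s ^ 2 ^ m * N ?d + N ?d * N (?y m)"
      using N_scale[OF d, of ?a] N_mult[OF d y_in[of m]] by (simp add: a)
    also have "N ?d * N (?y m) \<le> 1/2 * N (?y m)"
      using h N_nonneg[OF y_in] by (intro mult_right_mono) auto
    also have "s ^ 2 ^ m * N ?d < s ^ 2 ^ m * (1/2)"
      using h s by (intro mult_strict_left_mono) auto
    finally have "N (?y m) < s ^ 2 ^ m" by simp
    with s show ?thesis by (auto simp: T_def)
  qed
  \<comment> \<open>A step of this size moves the average by at most 1/4, which together with 1/4
    from \<open>near_unit\<close> stays below 1/2. The size is independent of the radius, so
    finitely many steps reach any positive radius.\<close>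
  define \<delta> where "\<delta> = 1 / (4 * (L + 1))"
  have \<delta>: "\<delta> > 0" "L * \<delta> \<le> 1/4" using L0 by (auto simp: \<delta>_def field_simps)
  have step: "s \<in> T" if t: "t \<in> T" and s: "s > 0" and ts: "\<bar>s - t\<bar> \<le> \<delta>" for s t
  proof -
    obtain m where m: "N (?h m (of_real t) - e) < 1/4" using near_unit[OF t, of "1/4"] by auto
    have "N (?h m (of_real s) - e) = N ((?h m (of_real s) - ?h m (of_real t)) + (?h m (of_real t) - e))"
      by simp
    also have "\<dots> \<le> N (?h m (of_real s) - ?h m (of_real t)) + N (?h m (of_real t) - e)"
      using h_in unit_in by (intro N_add diff_in)
    also have "N (?h m (of_real s) - ?h m (of_real t)) \<le> L * cmod (of_real s - of_real t)"
      using R Lip by (rule root_average_Lipschitz)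
    also have "cmod (of_real s - of_real t) = \<bar>s - t\<bar>"
      by (metis norm_of_real of_real_diff)
    also have "L * \<bar>s - t\<bar> \<le> L * \<delta>" using ts L0 by (intro mult_left_mono)
    finally have "N (?h m (of_real s) - e) < 1/2" using \<delta> m by linarith
    with s show ?thesis by (rule in_T)
  qed
  have start: "N x + 1 \<in> T"
    using N_nonneg[OF x] by (auto simp: T_def intro!: exI[of _ 0])
  have down: "s \<in> T" if "s > 0" "s \<le> N x + 1" "s \<ge> N x + 1 - real k * \<delta>" for k s
    using that
  proof (induction k arbitrary: s)
    case 0
    then show ?case using start by simp
  next
    case (Suc k)
    show ?case
    proof (rule step)
      let ?t = "min (N x + 1) (s + \<delta>)"
      show "?t \<in> T" using Suc \<delta> N_nonneg[OF x] by (intro Suc.IH) (auto simp: algebra_simps)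
      show "s > 0" by fact
      show "\<bar>s - ?t\<bar> \<le> \<delta>" using Suc \<delta> by auto
    qed
  qed
  \<comment> \<open>At this radius N h \<le> C s \<le> 1/2, whereas N (h - e) < 1/2; together they
    would give N e < 1.\<close>
  define s where "s = min (N x + 1) (1 / (2 * (C + 1)))"
  have s: "s > 0" "s \<le> N x + 1" "C * s \<le> 1/2"
  proof -
    show "s > 0" "s \<le> N x + 1" using C0 N_nonneg[OF x] by (auto simp: s_def)
    have "C * s \<le> C * (1 / (2 * (C + 1)))" using C0 by (intro mult_left_mono) (auto simp: s_def)
    also have "\<dots> \<le> 1/2" using C0 by (simp add: field_simps)
    finally show "C * s \<le> 1/2" .
  qed
  obtain k where "N x + 1 < real k * \<delta>" using reals_Archimedean3[OF \<delta>(1)] by blast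
  with s have "s \<in> T" by (intro down[of s k]) auto
  then obtain m where m: "N (?h m (of_real s) - e) < 1/2" using near_unit[of s "1/2"] by auto
  have "1 = N (?h m (of_real s) - (?h m (of_real s) - e))" by (simp add: N_unit)
  also have "\<dots> \<le> N (?h m (of_real s)) + N (?h m (of_real s) - e)"
    using h_in unit_in by (intro N_diff diff_in)
  also have "N (?h m (of_real s)) \<le> C * s"
    using root_average_bound[of R C m "of_real s"] R C s by simp
  finally show False using m s by linarith
qed

end

section \<open>Pointwise description of the algebra\<close>

lemma L0_class_eq_iff:
  assumes "f \<in> borel_measurable M" "g \<in> borel_measurable M"
  shows "L0_class M f = L0_class M g \<longleftrightarrow> (AE w in M. f w = g w)"
proof
  assume "L0_class M f = L0_class M g"
  then show "AE w in M. f w = g w" using L0_class_self[OF assms(1)] by (auto simp: L0_class_def)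
next
  assume *: "AE w in M. f w = g w"
  have "(AE w in M. h w = f w) \<longleftrightarrow> (AE w in M. h w = g w)" for h
    using * by (auto elim: AE_mp)
  then show "L0_class M f = L0_class M g" by (simp add: L0_class_def)
qed

text \<open>Exhaustion: countable unions whose measures approach the supremum are merged into one
  sequence that attains it, and a member not essentially covered would exceed it. The result
  replaces the union of an uncountable family, which may fail to be measurable.\<close>

lemma (in finite_measure) countable_essential_cover:
  assumes P: "\<And>S. P S \<Longrightarrow> S \<in> sets M" "P S0"
  obtains A :: "nat \<Rightarrow> 'a set"
    where "\<And>n. P (A n)" "\<And>S. P S \<Longrightarrow> AE w in M. w \<in> S \<longrightarrow> w \<in> (\<Union>n. A n)"
proof -
  define X where "X = {measure M (\<Union>n. A n) | A :: nat \<Rightarrow> 'a set. \<forall>n. P (A n)}"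
  have X_ne: "X \<noteq> {}" using P(2) by (auto simp: X_def intro!: exI[of _ "\<lambda>_. S0"])
  have X_bdd: "bdd_above X" by (intro bdd_aboveI[of _ "measure M (space M)"]) (auto simp: X_def bounded_measure)
  have "\<exists>A :: nat \<Rightarrow> 'a set. (\<forall>n. P (A n)) \<and> Sup X - 1 / real (Suc k) < measure M (\<Union>n. A n)" for k
  proof -
    have "Sup X - 1 / real (Suc k) < Sup X" by simp
    then obtain y where "y \<in> X" "Sup X - 1 / real (Suc k) < y"
      using less_cSup_iff[OF X_ne X_bdd] by blast
    then show ?thesis by (auto simp: X_def)
  qed
  then obtain A :: "nat \<Rightarrow> nat \<Rightarrow> 'a set" where A: "\<And>k n. P (A k n)"
    and A_less: "\<And>k. Sup X - 1 / real (Suc k) < measure M (\<Union>n. A k n)"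
    by metis
  define B where "B m = (case prod_decode m of (k, n) \<Rightarrow> A k n)" for m
  have B: "P (B m)" for m using A by (simp add: B_def split: prod.split)
  have B_sets: "(\<Union>m. B m) \<in> sets M" using B P(1) by blast
  have "A k n \<subseteq> (\<Union>m. B m)" for k n
    by (intro subset_trans[OF _ UN_upper[of "prod_encode (k, n)"]]) (auto simp: B_def)
  then have "measure M (\<Union>n. A k n) \<le> measure M (\<Union>m. B m)" for k
    using B_sets by (intro finite_measure_mono) auto
  then have B_ge: "Sup X \<le> measure M (\<Union>m. B m) + 1 / real (Suc k)" for k
    using A_less[of k] by (smt (verit, best))
  have "(\<lambda>k. measure M (\<Union>m. B m) + 1 / real (Suc k)) \<longlonglongrightarrow> measure M (\<Union>m. B m) + 0"
    using LIMSEQ_inverse_real_of_nat by (intro tendsto_intros) (simp add: inverse_eq_divide)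
  then have Sup_le: "Sup X \<le> measure M (\<Union>m. B m)"
    using B_ge by (intro LIMSEQ_le_const[of _ "measure M (\<Union>m. B m)"]) auto
  show thesis
  proof (rule that[of B])
    fix S assume S: "P S"
    \<comment> \<open>Prepending \<open>S\<close> makes the enlarged union a competitor for the
      supremum.\<close>
    define C where "C m = (case m of 0 \<Rightarrow> S | Suc n \<Rightarrow> B n)" for m
    have C_eq: "(\<Union>m. C m) = (\<Union>m. B m) \<union> (S - (\<Union>m. B m))"
    proof
      show "(\<Union>m. C m) \<subseteq> (\<Union>m. B m) \<union> (S - (\<Union>m. B m))"
        by (auto simp: C_def split: nat.splits)
      have "S = C 0" "\<And>m. B m = C (Suc m)" by (simp_all add: C_def)
      then show "(\<Union>m. B m) \<union> (S - (\<Union>m. B m)) \<subseteq> (\<Union>m. C m)" by blast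
    qed
    have "measure M (\<Union>m. C m) = measure M (\<Union>m. B m) + measure M (S - (\<Union>m. B m))"
      unfolding C_eq using B_sets P(1)[OF S] by (intro finite_measure_Union) auto
    moreover have "measure M (\<Union>m. C m) \<in> X"
      using B S by (auto simp: X_def C_def split: nat.splits intro!: exI[of _ C])
    then have "measure M (\<Union>m. C m) \<le> Sup X" using X_bdd by (rule cSup_upper)
    ultimately have "measure M (S - (\<Union>m. B m)) = 0"
      using Sup_le measure_nonneg[of M "S - (\<Union>m. B m)"] by linarith
    then have "S - (\<Union>m. B m) \<in> null_sets M"
      using B_sets P(1)[OF S] by (auto simp: null_sets_def emeasure_eq_measure)
    then have "AE w in M. w \<notin> S - (\<Union>m. B m)" by (rule AE_not_in)
    then show "AE w in M. w \<in> S \<longrightarrow> w \<in> (\<Union>m. B m)" by eventually_elim auto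
  qed (rule B)
qed

locale finite_BK_algebra = unital_Banach_Kantorovich_algebra M E sc nrm act e + finite_measure M
  for M :: "'w measure" and E :: "('w \<Rightarrow> complex) set set"
    and sc :: "complex \<Rightarrow> 'u::ring \<Rightarrow> 'u" and nrm :: "'u \<Rightarrow> ('w \<Rightarrow> complex) set"
    and act :: "('w \<Rightarrow> complex) set \<Rightarrow> 'u \<Rightarrow> 'u" and e :: 'u
begin

definition in_E :: "('w \<Rightarrow> complex) \<Rightarrow> bool" where
  "in_E f \<longleftrightarrow> f \<in> borel_measurable M \<and> L0_class M f \<in> E"

lemma in_E_measurable [measurable_dest]: "in_E f \<Longrightarrow> f \<in> borel_measurable M"
  by (simp add: in_E_def)

lemma E_cases:
  assumes "a \<in> E"
  obtains f where "in_E f" "a = L0_class M f"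
  using assms E_subset by (auto simp: L0_def in_E_def)

lemma in_E_bounded:
  assumes "f \<in> borel_measurable M" "AE w in M. cmod (f w) \<le> C"
  shows "in_E f"
  using assms L_infty_subset by (auto simp: in_E_def L_infty_def)

lemma in_E_const [simp, intro]: "in_E (\<lambda>_. c)"
  by (rule in_E_bounded[of _ "cmod c"]) auto

lemma in_E_indicator [intro]: "S \<in> sets M \<Longrightarrow> in_E (indicator S)"
  by (rule in_E_bounded[of _ 1]) (auto simp: indicator_def)

lemma in_E_add [intro]: "in_E f \<Longrightarrow> in_E g \<Longrightarrow> in_E (\<lambda>w. f w + g w)"
  using E_add[of "L0_class M f" "L0_class M g"]
  by (auto simp: in_E_def L0_add_def L0_lift2_class)

lemma in_E_mult [intro]: "in_E f \<Longrightarrow> in_E g \<Longrightarrow> in_E (\<lambda>w. f w * g w)"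
  using E_mult[of "L0_class M f" "L0_class M g"]
  by (auto simp: in_E_def L0_mult_def L0_lift2_class)

lemma in_E_uminus [intro]: "in_E f \<Longrightarrow> in_E (\<lambda>w. - f w)"
  using in_E_mult[OF in_E_const[of "-1"], of f] by simp

lemma in_E_diff [intro]: "in_E f \<Longrightarrow> in_E g \<Longrightarrow> in_E (\<lambda>w. f w - g w)"
  using in_E_add[OF _ in_E_uminus, of f g] by simp

lemma in_E_solid:
  assumes "f \<in> borel_measurable M" "in_E g" "AE w in M. cmod (f w) \<le> cmod (g w)"
  shows "in_E f"
proof -
  have [measurable]: "g \<in> borel_measurable M" using assms(2) by (rule in_E_measurable)
  have [measurable]: "f \<in> borel_measurable M" by fact
  have "L0_le M (L0_abs M (L0_class M f)) (L0_abs M (L0_class M g))"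
    using assms(3) by (simp add: L0_abs_def L0_lift1_class L0_le_class less_eq_complex_def)
  then show ?thesis using assms E_solid[of "L0_class M f" "L0_class M g"]
    by (auto simp: in_E_def L0_def)
qed

text \<open>Taking \<open>cmod\<close> of the chosen representative gives a function that is
  nonnegative at every point and not merely a.e.; by \<open>nrm_eq_nu\<close> it still represents
  the norm.\<close>

definition nu :: "'u \<Rightarrow> 'w \<Rightarrow> real" where
  "nu u w = cmod ((SOME f. f \<in> nrm u) w)"

lemma nu_nonneg [simp]: "0 \<le> nu u w" by (simp add: nu_def)

lemma nrm_eq_nu: "nrm u = L0_class M (\<lambda>w. complex_of_real (nu u w))"
  and nu_measurable [measurable]: "nu u \<in> borel_measurable M"
proof -
  obtain f where f: "in_E f" "nrm u = L0_class M f" using E_cases[OF nrm_in] .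
  then have [measurable]: "f \<in> borel_measurable M" by (simp add: in_E_def)
  define g where "g = (SOME f. f \<in> nrm u)"
  have nu: "nu u = (\<lambda>w. cmod (g w))" by (auto simp: nu_def g_def)
  have "g \<in> nrm u" unfolding g_def by (rule someI[of _ f]) (simp add: f L0_class_self)
  then have [measurable]: "g \<in> borel_measurable M" and gf: "AE w in M. g w = f w"
    by (auto simp: f L0_class_def)
  have "AE w in M. 0 \<le> f w"
    using nrm_nonneg[of u] by (simp add: f L0_const_def L0_le_class)
  with gf have "AE w in M. f w = complex_of_real (cmod (g w))"
    by eventually_elim (auto simp: less_eq_complex_def complex_eq_iff cmod_def)
  then show "nrm u = L0_class M (\<lambda>w. complex_of_real (nu u w))"
    by (simp add: f nu L0_class_eq_iff)
  show "nu u \<in> borel_measurable M" by (simp add: nu)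
qed

lemma in_E_nu [intro]: "in_E (\<lambda>w. complex_of_real (nu u w))"
  using nrm_in[of u] by (simp add: in_E_def flip: nrm_eq_nu)

lemma nu_eq_0_iff: "(AE w in M. nu u w = 0) \<longleftrightarrow> u = 0"
  using nrm_zero_iff[of u] by (simp add: nrm_eq_nu L0_const_def L0_class_eq_iff)

lemma nu_zero: "AE w in M. nu 0 w = 0"
  by (simp add: nu_eq_0_iff)

lemma nu_unit: "AE w in M. nu e w = 1"
  using nrm_unit by (simp add: nrm_eq_nu L0_const_def L0_class_eq_iff)

lemma nu_scale: "AE w in M. nu (sc l u) w = cmod l * nu u w"
  using nrm_scale[of l u]
  by (simp add: nrm_eq_nu L0_const_def L0_class_eq_iff L0_mult_def L0_lift2_class
      flip: of_real_mult)

lemma nu_uminus: "AE w in M. nu (- u) w = nu u w"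
  using nu_scale[of "-1" u] by simp

lemma nu_add: "AE w in M. nu (u + v) w \<le> nu u w + nu v w"
  using nrm_triangle[of u v]
  by (simp add: nrm_eq_nu L0_add_def L0_lift2_class L0_le_class less_eq_complex_def)

lemma nu_diff: "AE w in M. nu (u - v) w \<le> nu u w + nu v w"
  using nu_add[of u "- v"] nu_uminus[of v] by eventually_elim simp

lemma nu_mult: "AE w in M. nu (u * v) w \<le> nu u w * nu v w"
  using nrm_mult[of u v]
  by (simp add: nrm_eq_nu L0_mult_def L0_lift2_class L0_le_class less_eq_complex_def)

section \<open>The module action expressed by representatives\<close>

definition smul :: "('w \<Rightarrow> complex) \<Rightarrow> 'u \<Rightarrow> 'u" where
  "smul f u = act (L0_class M f) u"

lemma smul_cong:
  "in_E f \<Longrightarrow> in_E g \<Longrightarrow> AE w in M. f w = g w \<Longrightarrow> smul f u = smul g u"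
  using L0_class_eq_iff[of f M g] by (simp add: smul_def in_E_def)

lemma smul_add_right: "in_E f \<Longrightarrow> smul f (u + v) = smul f u + smul f v"
  by (simp add: smul_def in_E_def act_add_right)

lemma smul_zero_right: "in_E f \<Longrightarrow> smul f 0 = 0"
  using smul_add_right[of f 0 0] by simp

lemma smul_uminus_right: "in_E f \<Longrightarrow> smul f (- u) = - smul f u"
  using smul_add_right[of f u "- u"] smul_zero_right[of f] by (simp add: eq_neg_iff_add_eq_0 add.commute)

lemma smul_diff_right: "in_E f \<Longrightarrow> smul f (u - v) = smul f u - smul f v"
  using smul_add_right[of f u "- v"] by (simp add: smul_uminus_right)

lemma smul_add_left: "in_E f \<Longrightarrow> in_E g \<Longrightarrow> smul (\<lambda>w. f w + g w) u = smul f u + smul g u"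
  using act_add_left[of "L0_class M f" "L0_class M g" u]
  by (simp add: smul_def in_E_def L0_add_def L0_lift2_class)

lemma smul_smul: "in_E f \<Longrightarrow> in_E g \<Longrightarrow> smul f (smul g u) = smul (\<lambda>w. f w * g w) u"
  using act_mult[of "L0_class M f" "L0_class M g" u]
  by (simp add: smul_def in_E_def L0_mult_def L0_lift2_class)

lemma smul_const: "smul (\<lambda>_. c) u = sc c u"
  using act_scale[of "L0_one M" c u] act_one[of u] in_E_const[of 1, unfolded in_E_def]
  by (simp add: smul_def in_E_def L0_const_def L0_mult_def L0_lift2_class)

lemma smul_mult_left: "in_E f \<Longrightarrow> smul f u * v = smul f (u * v)"
  by (simp add: smul_def in_E_def act_mult_left)

lemma smul_mult_right: "in_E f \<Longrightarrow> u * smul f v = smul f (u * v)"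
  by (simp add: smul_def in_E_def act_mult_right)

lemma nu_smul:
  assumes f: "in_E f"
  shows "AE w in M. nu (smul f u) w = cmod (f w) * nu u w"
proof -
  note [measurable] = in_E_measurable[OF f]
  have "nrm (smul f u) = L0_mult M (L0_abs M (L0_class M f)) (nrm u)"
    using f nrm_act by (simp add: smul_def in_E_def)
  then show ?thesis
    by (simp add: nrm_eq_nu L0_abs_def L0_lift1_class L0_mult_def L0_lift2_class
        L0_class_eq_iff flip: of_real_mult)
qed

text \<open>A representative with f * f = f takes only the values 0 and 1 a.e., so the set where it
  equals 1 describes it.\<close>

lemma idempotents_iff:
  "p \<in> idempotents M E \<longleftrightarrow> (\<exists>S\<in>sets M. p = L0_class M (indicator S))"
proof
  assume p: "p \<in> idempotents M E"
  then obtain f where f: "in_E f" "p = L0_class M f" by (auto simp: idempotents_def elim: E_cases)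
  then have [measurable]: "f \<in> borel_measurable M" by (simp add: in_E_def)
  have ff: "AE w in M. f w * f w = f w"
    using p by (simp add: f idempotents_def L0_mult_def L0_lift2_class L0_class_eq_iff)
  define S where "S = {w \<in> space M. f w = 1}"
  have S: "S \<in> sets M" unfolding S_def by measurable
  have "AE w in M. f w = indicator S w"
    using ff AE_space by eventually_elim (auto simp: S_def indicator_def)
  then have "p = L0_class M (indicator S)" using S by (simp add: f L0_class_eq_iff)
  with S show "\<exists>S\<in>sets M. p = L0_class M (indicator S)" by blast
next
  assume "\<exists>S\<in>sets M. p = L0_class M (indicator S)"
  then obtain S where S: "S \<in> sets M" "p = L0_class M (indicator S)" by blast
  have "(\<lambda>w. indicator S w * indicator S w) = (indicator S :: 'w \<Rightarrow> complex)"
    by (auto simp: indicator_def)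
  then show "p \<in> idempotents M E"
    using in_E_indicator[OF S(1)] S by (simp add: idempotents_def in_E_def L0_mult_def L0_lift2_class)
qed

lemma indicator_eq_zero_iff:
  "S \<in> sets M \<Longrightarrow> L0_class M (indicator S) = L0_zero M \<longleftrightarrow> (AE w in M. w \<notin> S)"
  by (simp add: L0_const_def L0_class_eq_iff indicator_def)

text \<open>
  The infimum of the dominating net is zero, so on some part of a set of positive measure one of
  its members lies below a prescribed positive function.
\<close>

lemma o_tendsto_small:
  fixes a :: "'i \<Rightarrow> 'w \<Rightarrow> complex" and b :: "'w \<Rightarrow> complex" and \<epsilon> :: "'w \<Rightarrow> real"
  assumes lim: "o_tendsto M E (\<lambda>i. L0_class M (a i)) (L0_class M b) F"
    and a: "\<And>i. a i \<in> borel_measurable M" and b: "b \<in> borel_measurable M"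
    and S: "S \<in> sets M" "\<not> (AE w in M. w \<notin> S)"
    and \<epsilon>: "\<epsilon> \<in> borel_measurable M" "\<And>w. w \<in> S \<Longrightarrow> \<epsilon> w > 0"
  obtains T where "T \<in> sets M" "T \<subseteq> S" "\<not> (AE w in M. w \<notin> T)"
    "\<forall>\<^sub>F i in F. AE w in M. w \<in> T \<longrightarrow> cmod (a i w - b w) \<le> \<epsilon> w"
proof -
  note [measurable] = a b S(1) \<epsilon>(1)
  obtain D where D: "D \<subseteq> E"
    and D0: "\<forall>d\<in>D. L0_le M (L0_zero M) d"
    and Dinf: "\<forall>c\<in>E. (\<forall>d\<in>D. L0_le M c d) \<longrightarrow> L0_le M c (L0_zero M)"
    and Dev: "\<forall>d\<in>D. \<forall>\<^sub>F i in F. L0_le M (L0_abs M (L0_diff M (L0_class M (a i)) (L0_class M b))) d"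
    using lim unfolding o_tendsto_def by blast
  \<comment> \<open>Truncation at 1 puts \<open>c\<close> into \<open>E\<close>. As \<open>S\<close>
    is nonnull, \<open>c\<close> is not \<le> 0 and so is no lower bound of \<open>D\<close>. A
    member of \<open>D\<close> that is not above \<open>c\<close> must drop to \<epsilon> or below
    on a nonnull part of \<open>S\<close>.\<close>
  define c where "c w = complex_of_real (if w \<in> S then min (\<epsilon> w) 1 else 0)" for w
  have c_meas [measurable]: "c \<in> borel_measurable M" unfolding c_def by measurable
  have c: "in_E c"
  proof (rule in_E_bounded)
    have "cmod (c w) \<le> 1" for w using \<epsilon>(2)[of w] by (auto simp: c_def abs_if)
    then show "AE w in M. cmod (c w) \<le> 1" by simp
  qed simp
  have "\<not> L0_le M (L0_class M c) (L0_zero M)"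
  proof
    assume "L0_le M (L0_class M c) (L0_zero M)"
    then have "AE w in M. c w \<le> 0" by (simp add: L0_const_def L0_le_class)
    then have "AE w in M. w \<notin> S"
    proof eventually_elim
      case (elim w)
      then show ?case using \<epsilon>(2)[of w] by (auto simp: c_def less_eq_complex_def)
    qed
    with S show False by simp
  qed
  then obtain d where d: "d \<in> D" "\<not> L0_le M (L0_class M c) d"
    using Dinf c by (auto simp: in_E_def)
  obtain f where f: "in_E f" "d = L0_class M f" using d(1) D E_cases by blast
  then have [measurable]: "f \<in> borel_measurable M" by (simp add: in_E_def)
  have f0: "AE w in M. 0 \<le> f w" using bspec[OF D0 d(1)] by (simp add: f L0_const_def L0_le_class)
  define T where "T = {w \<in> space M. w \<in> S \<and> Re (f w) \<le> \<epsilon> w}"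
  show thesis
  proof (rule that[of T])
    show "T \<in> sets M" unfolding T_def by measurable
    show "T \<subseteq> S" by (auto simp: T_def)
    show "\<not> (AE w in M. w \<notin> T)"
    proof
      assume "AE w in M. w \<notin> T"
      then have "AE w in M. c w \<le> f w"
        using f0 AE_space by eventually_elim (auto simp: T_def c_def less_eq_complex_def)
      with d(2) show False by (simp add: f L0_le_class)
    qed
    show "\<forall>\<^sub>F i in F. AE w in M. w \<in> T \<longrightarrow> cmod (a i w - b w) \<le> \<epsilon> w"
      using Dev[rule_format, OF d(1)]
    proof eventually_elim
      case (elim i)
      then have "AE w in M. complex_of_real (cmod (a i w - b w)) \<le> f w"
        by (simp add: f L0_abs_def L0_diff_def L0_lift2_class L0_lift1_class L0_le_class)
      then show ?case by eventually_elim (auto simp: T_def less_eq_complex_def)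
    qed
  qed
qed

text \<open>The limit \<open>v\<close> is delivered as a vanishing criterion, the form in which
  identities for \<open>v\<close> are proved. If z \<noteq> 0, then on a nonnull part of {nu z > 0}
  the term K * nu (v - s n) is eventually at most nu z / 2, so nu z / 2 \<le> b n there, against b n
  tending to 0.\<close>

lemma Cauchy_limit:
  assumes c: "decseq c" "c \<longlonglongrightarrow> 0"
    and Cauchy: "\<And>k m n. k \<le> m \<Longrightarrow> k \<le> n \<Longrightarrow> AE w in M. nu (s m - s n) w \<le> c k"
  obtains v where "\<And>z K b. b \<longlonglongrightarrow> 0 \<Longrightarrow>
    (\<And>n. AE w in M. nu z w \<le> K * nu (v - s n) w + b n) \<Longrightarrow> z = 0"
proof -
  have c0: "0 \<le> c k" for k using decseq_ge[OF c] .
  define D where "D = range (\<lambda>k. L0_const M (complex_of_real (c k)))"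
  have D: "D \<subseteq> E" using in_E_const[unfolded in_E_def] by (auto simp: D_def L0_const_def)
  let ?F = "filtermap s sequentially"
  have "o_tendsto M E (\<lambda>(u, v). nrm (u - v)) (L0_zero M) (?F \<times>\<^sub>F ?F)"
    unfolding o_tendsto_def
  proof (intro exI[of _ D] conjI ballI impI)
    show "D \<subseteq> E" "D \<noteq> {}" using D by (auto simp: D_def)
  next
    fix d d' assume "d \<in> D" "d' \<in> D"
    then obtain k k' where "d = L0_const M (c k)" "d' = L0_const M (c k')" by (auto simp: D_def)
    then show "\<exists>d''\<in>D. L0_le M d'' d \<and> L0_le M d'' d'"
      using c(1) by (intro bexI[of _ "L0_const M (c (max k k'))"])
        (auto simp: D_def L0_const_def L0_le_class less_eq_complex_def decseq_def)
  next
    fix d assume "d \<in> D"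
    then show "L0_le M (L0_zero M) d"
      using c0 by (auto simp: D_def L0_const_def L0_le_class less_eq_complex_def)
  next
    fix a assume "a \<in> E" and *: "\<forall>d\<in>D. L0_le M a d"
    then obtain f where f: "in_E f" "a = L0_class M f" using E_cases by blast
    then have "AE w in M. f w \<le> complex_of_real (c k)" for k
      using * by (auto simp: D_def L0_const_def L0_le_class in_E_def)
    then have "AE w in M. \<forall>k. f w \<le> complex_of_real (c k)" by (simp add: AE_all_countable)
    then have "AE w in M. f w \<le> 0"
    proof eventually_elim
      case (elim w)
      then have "\<And>k. Re (f w) \<le> c k" "Im (f w) = 0" by (auto simp: less_eq_complex_def)
      then show ?case using LIMSEQ_le_const[OF c(2), of "Re (f w)"] by (auto simp: less_eq_complex_def)
    qed
    then show "L0_le M a (L0_zero M)" using f by (simp add: L0_const_def L0_le_class in_E_def)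
  next
    fix d assume "d \<in> D"
    then obtain k where d: "d = L0_const M (c k)" by (auto simp: D_def)
    have "L0_le M (L0_abs M (L0_diff M (nrm (s m - s n)) (L0_zero M))) d" if "k \<le> m" "k \<le> n" for m n
      using Cauchy[OF that]
      by (simp add: d nrm_eq_nu L0_const_def L0_abs_def L0_diff_def L0_lift2_class L0_lift1_class
          L0_le_class less_eq_complex_def)
    then have "\<forall>\<^sub>F (m, n) in sequentially \<times>\<^sub>F sequentially.
        L0_le M (L0_abs M (L0_diff M (nrm (s m - s n)) (L0_zero M))) d"
      by (auto simp: eventually_prod_sequentially intro!: exI[of _ k])
    then show "\<forall>\<^sub>F i in ?F \<times>\<^sub>F ?F.
        L0_le M (L0_abs M (L0_diff M ((\<lambda>(u, v). nrm (u - v)) i) (L0_zero M))) d"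
      by (simp add: prod_filtermap1 prod_filtermap2 eventually_filtermap case_prod_unfold)
  qed
  then obtain v where "o_tendsto M E (\<lambda>u. nrm (v - u)) (L0_zero M) ?F"
    using bo_complete[of ?F] by (auto simp: filtermap_bot_iff)
  then have lim: "o_tendsto M E (\<lambda>u. L0_class M (\<lambda>w. complex_of_real (nu (v - u) w)))
      (L0_class M (\<lambda>_. 0)) ?F"
    by (simp add: nrm_eq_nu L0_const_def)
  show thesis
  proof (rule that[of v])
    fix z K b
    assume b: "b \<longlonglongrightarrow> 0" and z: "\<And>n. AE w in M. nu z w \<le> K * nu (v - s n) w + b n"
    \<comment> \<open>Raising K to at least 1 allows division by it and only weakens the hypothesis,
      since \<open>nu\<close> is nonnegative.\<close>
    define K' where "K' = max K 1"
    have K': "K' \<ge> 1" "K \<le> K'" by (auto simp: K'_def)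
    define S where "S = {w \<in> space M. nu z w > 0}"
    show "z = 0"
    proof (rule ccontr)
      assume "z \<noteq> 0"
      have S: "\<not> (AE w in M. w \<notin> S)"
      proof
        assume "AE w in M. w \<notin> S"
        with AE_space have "AE w in M. nu z w = 0"
          by eventually_elim (auto simp: S_def not_less intro: antisym)
        with \<open>z \<noteq> 0\<close> show False by (simp add: nu_eq_0_iff)
      qed
      have "S \<in> sets M" unfolding S_def by measurable
      then obtain T where T: "T \<in> sets M" "T \<subseteq> S" "\<not> (AE w in M. w \<notin> T)"
        and ev: "\<forall>\<^sub>F u in ?F. AE w in M. w \<in> T \<longrightarrow>
          cmod (complex_of_real (nu (v - u) w) - 0) \<le> nu z w / (2 * K')"
        using o_tendsto_small[OF lim _ _ _ S, of "\<lambda>w. nu z w / (2 * K')"] K'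
        by (auto simp: S_def)
      have T0: "w \<in> T \<Longrightarrow> nu z w > 0" for w using T(2) by (auto simp: S_def)
      from ev obtain n0 where n0: "\<And>n. n \<ge> n0 \<Longrightarrow>
          AE w in M. w \<in> T \<longrightarrow> nu (v - s n) w \<le> nu z w / (2 * K')"
        by (auto simp: eventually_filtermap eventually_sequentially)
      have "AE w in M. w \<in> T \<longrightarrow> nu z w / 2 \<le> b n" if "n \<ge> n0" for n
        using n0[OF that] z[of n]
      proof eventually_elim
        case (elim w)
        show ?case
        proof
          assume "w \<in> T"
          have "K * nu (v - s n) w \<le> K' * nu (v - s n) w"
            using K' by (intro mult_right_mono) auto
          also have "\<dots> \<le> K' * (nu z w / (2 * K'))"
            using elim(1) \<open>w \<in> T\<close> K' by (intro mult_left_mono) auto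
          also have "\<dots> = nu z w / 2" using K' by simp
          finally show "nu z w / 2 \<le> b n" using elim(2) by linarith
        qed
      qed
      then have "AE w in M. \<forall>n. n \<ge> n0 \<longrightarrow> w \<in> T \<longrightarrow> nu z w / 2 \<le> b n"
        unfolding AE_all_countable by (auto intro: AE_I2)
      then have "AE w in M. w \<notin> T"
      proof eventually_elim
        case (elim w)
        then show ?case
          using LIMSEQ_le_const[OF b, of "nu z w / 2"] T0[of w] by force
      qed
      with T(3) show False by simp
    qed
  qed
qed

section \<open>Invertibility on a measurable set\<close>

text \<open>The bound is required on the whole space although the applications are local: there
  \<open>u\<close> is a product with a factor supported on a set \<open>S\<close>, hence zero off
  \<open>S\<close>. The inverse is the (bo)-limit of the partial sums \<open>s n\<close>.\<close>

lemma neumann: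
  assumes r: "0 \<le> r" "r < 1" and u: "AE w in M. nu u w \<le> r"
  obtains v where "(e - u) * v = e" "v * (e - u) = e"
proof -
  define p where "p = rec_nat e (\<lambda>_ y. u * y)"
  have p_simps: "p 0 = e" "p (Suc n) = u * p n" for n by (simp_all add: p_def)
  have p_commute: "p n * u = u * p n" for n
    by (induction n) (simp_all add: p_simps unit_left unit_right mult.assoc)
  define s where "s n = (\<Sum>k<n. p k)" for n
  have telescope: "(e - u) * p n = p n - p (Suc n)" "p n * (e - u) = p n - p (Suc n)" for n
    by (simp_all add: p_simps p_commute left_diff_distrib right_diff_distrib unit_left unit_right)
  have left: "(e - u) * s n = e - p n" for n
    by (induction n) (simp_all add: s_def p_simps(1) telescope distrib_left)
  have right: "s n * (e - u) = e - p n" for n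
    by (induction n) (simp_all add: s_def p_simps(1) telescope distrib_right)
  have p_le: "AE w in M. nu (p n) w \<le> r ^ n" for n
  proof (induction n)
    case 0
    show ?case using nu_unit by eventually_elim (simp add: p_simps)
  next
    case (Suc n)
    then show ?case using u nu_mult[of u "p n"]
    proof eventually_elim
      case (elim w)
      have "nu u w * nu (p n) w \<le> r * r ^ n" using elim r by (intro mult_mono) auto
      with elim show ?case by (simp add: p_simps)
    qed
  qed
  have s_le: "AE w in M. nu (s (n + i) - s n) w \<le> r ^ n / (1 - r)" for n i
  proof -
    \<comment> \<open>The induction carries the exact geometric sum, because the bound r^n / (1 - r)
      alone does not reproduce itself.\<close>
    have "AE w in M. nu (s (n + i) - s n) w \<le> r ^ n * (1 - r ^ i) / (1 - r)"
    proof (induction i)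
      case 0
      show ?case using nu_zero by eventually_elim simp
    next
      case (Suc i)
      have eq: "s (n + Suc i) - s n = (s (n + i) - s n) + p (n + i)" by (simp add: s_def)
      show ?case using Suc p_le[of "n + i"] nu_add[of "s (n + i) - s n" "p (n + i)"] unfolding eq
      proof eventually_elim
        case (elim w)
        have "r ^ n * (1 - r ^ i) / (1 - r) + r ^ (n + i) = r ^ n * (1 - r ^ Suc i) / (1 - r)"
          using r by (simp add: field_simps power_add)
        with elim show ?case by (simp del: add_Suc_right)
      qed
    qed
    then show ?thesis
    proof eventually_elim
      case (elim w)
      have "r ^ n * (1 - r ^ i) / (1 - r) \<le> r ^ n * 1 / (1 - r)"
        using r by (intro divide_right_mono mult_left_mono) auto
      with elim show ?case by simp
    qed
  qed
  obtain v where v: "\<And>z K b. b \<longlonglongrightarrow> 0 \<Longrightarrow>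
      (\<And>n. AE w in M. nu z w \<le> K * nu (v - s n) w + b n) \<Longrightarrow> z = 0"
  proof (rule Cauchy_limit[of "\<lambda>k. r ^ k / (1 - r)" s])
    show "decseq (\<lambda>k. r ^ k / (1 - r))"
      unfolding decseq_def using r by (auto intro!: divide_right_mono power_decreasing)
    show "(\<lambda>k. r ^ k / (1 - r)) \<longlonglongrightarrow> 0"
      using tendsto_divide[OF LIMSEQ_realpow_zero[OF r] tendsto_const, of "1 - r"] r by simp
    have mono: "AE w in M. nu (s m - s n) w \<le> r ^ k / (1 - r)" if "k \<le> n" "n \<le> m" for k m n
      using s_le[of n "m - n"]
    proof eventually_elim
      case (elim w)
      have "r ^ n / (1 - r) \<le> r ^ k / (1 - r)"
        using r that by (intro divide_right_mono power_decreasing) auto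
      with elim that show ?case by simp
    qed
    fix k m n :: nat assume "k \<le> m" "k \<le> n"
    then show "AE w in M. nu (s m - s n) w \<le> r ^ k / (1 - r)"
      using mono[of k n m] mono[of k m n] nu_uminus[of "s n - s m"]
      by (cases "n \<le> m") auto
  qed blast
  \<comment> \<open>Since nu (e - u) \<le> 1 + r, the constant K = 2 works in the criterion for both
    products.\<close>
  have y: "AE w in M. nu (e - u) w \<le> 2"
    using nu_diff[of e u] nu_unit u by eventually_elim (use r in linarith)
  have "(e - u) * v - e = 0"
  proof (rule v[OF LIMSEQ_realpow_zero[OF r]])
    fix n
    have eq: "(e - u) * v - e = (e - u) * (v - s n) - p n"
      using left[of n] by (simp add: right_diff_distrib)
    show "AE w in M. nu ((e - u) * v - e) w \<le> 2 * nu (v - s n) w + r ^ n"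
      unfolding eq
      using nu_diff[of "(e - u) * (v - s n)" "p n"] nu_mult[of "e - u" "v - s n"] p_le[of n] y
    proof eventually_elim
      case (elim w)
      have "nu (e - u) w * nu (v - s n) w \<le> 2 * nu (v - s n) w"
        using elim by (intro mult_right_mono) auto
      with elim show ?case by simp
    qed
  qed
  moreover have "v * (e - u) - e = 0"
  proof (rule v[OF LIMSEQ_realpow_zero[OF r]])
    fix n
    have eq: "v * (e - u) - e = (v - s n) * (e - u) - p n"
      using right[of n] by (simp add: left_diff_distrib)
    show "AE w in M. nu (v * (e - u) - e) w \<le> 2 * nu (v - s n) w + r ^ n"
      unfolding eq
      using nu_diff[of "(v - s n) * (e - u)" "p n"] nu_mult[of "v - s n" "e - u"] p_le[of n] y
    proof eventually_elim
      case (elim w)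
      have "nu (v - s n) w * nu (e - u) w \<le> nu (v - s n) w * 2"
        using elim by (intro mult_left_mono) auto
      with elim show ?case by simp
    qed
  qed
  ultimately show thesis by (intro that[of v]) auto
qed

section \<open>Localization to a measurable set\<close>

abbreviation res :: "'w set \<Rightarrow> 'u \<Rightarrow> 'u" where
  "res S \<equiv> smul (indicator S)"

lemma res_smul:
  assumes "S \<in> sets M" "in_E f"
  shows "res S (smul f u) = smul (\<lambda>w. indicator S w * f w) u"
  using assms by (intro smul_smul) auto

lemma smul_commute: "in_E f \<Longrightarrow> in_E g \<Longrightarrow> smul f (smul g u) = smul g (smul f u)"
  by (simp add: smul_smul mult.commute)

lemma res_smul_cong:
  assumes S: "S \<in> sets M" and fg: "in_E f" "in_E g" "AE w in M. w \<in> S \<longrightarrow> f w = g w"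
  shows "res S (smul f u) = res S (smul g u)"
proof -
  have "AE w in M. indicator S w * f w = indicator S w * g w"
    using fg(3) by eventually_elim (auto simp: indicator_def)
  then show ?thesis
    using S fg by (auto simp: res_smul intro!: smul_cong)
qed

lemma res_res:
  assumes "S \<in> sets M" "T \<in> sets M" "T \<subseteq> S"
  shows "res T (res S u) = res T u"
proof -
  have "(\<lambda>w. indicator T w * indicator S w) = (indicator T :: 'w \<Rightarrow> complex)"
    using assms(3) by (auto simp: indicator_def fun_eq_iff)
  then show ?thesis using assms by (simp add: res_smul in_E_indicator)
qed

lemma res_mult:
  assumes "S \<in> sets M"
  shows "res S u * res S v = res S (u * v)"
  using assms by (simp add: smul_mult_left smul_mult_right in_E_indicator res_res)

lemma res_eq_self:
  assumes "S \<in> sets M" "in_E f" "\<And>w. w \<notin> S \<Longrightarrow> f w = 0"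
  shows "res S (smul f u) = smul f u"
proof -
  have "(\<lambda>w. indicator S w * f w) = f" using assms(3) by (auto simp: indicator_def fun_eq_iff)
  then show ?thesis using assms by (simp add: res_smul)
qed

lemma nu_res: "S \<in> sets M \<Longrightarrow> AE w in M. nu (res S u) w = indicator S w * nu u w"
  using nu_smul[OF in_E_indicator, of S u] by (auto simp: indicator_def)

text \<open>The inverse in the corner with unit \<open>res S e\<close> is named explicitly, because
  its norm has to be controlled; \<open>res S v = v\<close> makes that norm vanish a.e. off
  \<open>S\<close>.\<close>

definition inverse_on :: "'w set \<Rightarrow> 'u \<Rightarrow> 'u \<Rightarrow> bool" where
  "inverse_on S u v \<longleftrightarrow> res S v = v \<and> u * v = res S e \<and> v * u = res S e"

lemma inverse_on_subset:
  assumes "inverse_on S (res S u) v" "S \<in> sets M" "T \<in> sets M" "T \<subseteq> S"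
  shows "inverse_on T (res T u) (res T v)"
proof -
  have T: "res T a = res T (res S a)" for a using assms by (simp add: res_res)
  have "res T (u * v) = res T (res S u * v)" "res T (v * u) = res T (v * res S u)"
    using assms(2) T[of "u * v"] T[of "v * u"]
    by (simp_all add: smul_mult_left smul_mult_right in_E_indicator)
  with assms show ?thesis
    by (simp add: inverse_on_def res_mult res_res)
qed

text \<open>As \<open>d\<close> lives on \<open>S\<close>, u v d = d and hence u - d = u (e - v d).
  With z the Neumann inverse of e - v d, the new inverse is z v; commutation of \<open>d\<close>
  with \<open>v\<close> makes it two-sided. The bound follows from z v = v + (v d)(z v).\<close>

lemma inverse_on_perturb:
  assumes S: "S \<in> sets M" and inv: "inverse_on S u v" and d: "res S d = d" "d * v = v * d"
    and r: "0 \<le> r" "r < 1" and vd: "AE w in M. nu (v * d) w \<le> r"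
  obtains v' where "inverse_on S (u - d) v'" "AE w in M. nu v' w \<le> nu v w / (1 - r)"
proof -
  obtain z where z: "(e - v * d) * z = e" "z * (e - v * d) = e"
    using neumann[OF r vd] .
  have v: "res S v = v" "u * v = res S e" "v * u = res S e" using inv by (auto simp: inverse_on_def)
  have S': "in_E (indicator S)" using S by auto
  have "u * (v * d) = d"
    using d S' by (simp add: v smul_mult_left unit_left flip: mult.assoc)
  then have ud: "u - d = u * (e - v * d)" by (simp add: right_diff_distrib unit_right)
  have "v * d * u = d"
    using d S' v(3) by (metis mult.assoc smul_mult_right unit_right)
  then have du: "u - d = (e - v * d) * u" by (simp add: left_diff_distrib unit_left)
  have "v * (e - v * d) = (e - v * d) * v"
    by (simp add: algebra_simps unit_left unit_right d(2))
  \<comment> \<open>The commutation of \<open>v\<close> with e - v d is multiplied by z on both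
    sides, which cancels e - v d and leaves z v = v z.\<close>
  then have "z * v * ((e - v * d) * z) = z * (e - v * d) * (v * z)"
    by (metis mult.assoc)
  then have zv: "z * v = v * z" by (simp add: z unit_left unit_right)
  show thesis
  proof (rule that[of "z * v"])
    have "(u - d) * (z * v) = u * ((e - v * d) * z) * v" by (simp add: ud mult.assoc)
    also have "\<dots> = res S e" by (simp add: z unit_right v)
    finally have 1: "(u - d) * (z * v) = res S e" .
    have "z * v * (u - d) = v * (z * (e - v * d)) * u" by (simp add: du zv mult.assoc)
    also have "\<dots> = res S e" by (simp add: z unit_right v)
    finally have 2: "z * v * (u - d) = res S e" .
    show "inverse_on S (u - d) (z * v)"
      unfolding inverse_on_def using 1 2 S' v(1) by (simp flip: smul_mult_right)
    have "(e - v * d) * (z * v) = v" by (simp add: z unit_left flip: mult.assoc)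
    then have "z * v = v + v * d * (z * v)" by (simp add: left_diff_distrib unit_left algebra_simps)
    then have eq: "nu (z * v) = nu (v + v * d * (z * v))" by simp
    show "AE w in M. nu (z * v) w \<le> nu v w / (1 - r)"
      using nu_add[of v "v * d * (z * v)"] nu_mult[of "v * d" "z * v"] vd
    proof eventually_elim
      case (elim w)
      have "nu (v * d) w * nu (z * v) w \<le> r * nu (z * v) w"
        using elim by (intro mult_right_mono) auto
      with elim have "nu (z * v) w \<le> nu v w + r * nu (z * v) w" unfolding eq by simp
      then show ?case using r by (simp add: field_simps)
    qed
  qed
qed

text \<open>The perturbation is (f - g) e cut off to \<open>S\<close>, which commutes with
  everything; the ratio 1/2 in the Neumann series produces the factor 2 in the new bound.\<close>

lemma inverse_on_perturb_scalar:
  assumes S: "S \<in> sets M" and fg: "in_E f" "in_E g"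
    and inv: "inverse_on S (res S (smul f e - x)) v"
    and le: "AE w in M. w \<in> S \<longrightarrow> cmod (f w - g w) * nu v w \<le> 1 / 2"
  obtains v' where "inverse_on S (res S (smul g e - x)) v'" "AE w in M. nu v' w \<le> 2 * nu v w"
proof -
  have S': "in_E (indicator S)" using S by auto
  define h where "h = (\<lambda>w. indicator S w * (f w - g w))"
  have h: "in_E h" using S' fg by (auto simp: h_def)
  have res_h: "res S (smul h e) = smul h e"
    using S h by (rule res_eq_self) (simp add: h_def)
  have diff: "smul (\<lambda>w. f w - g w) e = smul f e - smul g e"
  proof -
    have "smul (\<lambda>w. g w + (f w - g w)) e = smul g e + smul (\<lambda>w. f w - g w) e"
      using fg by (intro smul_add_left) auto
    then show ?thesis by simp
  qed
  have "smul h e = res S (smul (\<lambda>w. f w - g w) e)"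
    unfolding h_def using S fg by (subst res_smul) auto
  then have eq: "res S (smul f e - x) - smul h e = res S (smul g e - x)"
    using S' by (simp add: diff smul_diff_right)
  have "v * smul h e = smul h v" by (simp add: smul_mult_right h unit_right)
  then have "AE w in M. nu (v * smul h e) w = cmod (h w) * nu v w" using nu_smul[OF h] by simp
  then have "AE w in M. nu (v * smul h e) w \<le> 1 / 2"
    using le by eventually_elim (auto simp: h_def indicator_def)
  moreover have "smul h e * v = v * smul h e"
    by (simp add: smul_mult_left smul_mult_right h unit_left unit_right)
  ultimately obtain v' where "inverse_on S (res S (smul f e - x) - smul h e) v'"
      "AE w in M. nu v' w \<le> nu v w / (1 - 1 / 2)"
    using inverse_on_perturb[OF S inv res_h, of "1/2"] by auto
  then show thesis by (intro that[of v']) (auto simp: eq mult.commute)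
qed

section \<open>Boundedness, closedness and cyclicity of the spectrum\<close>

lemma spm_iff:
  assumes "in_E f"
  shows "L0_class M f \<in> spm M E act e x \<longleftrightarrow>
    (\<forall>S\<in>sets M. \<not> (AE w in M. w \<notin> S) \<longrightarrow> \<not> (\<exists>v. inverse_on S (res S (smul f e - x)) v))"
proof -
  have "u \<in> Inv (range (res S)) (res S e) \<longleftrightarrow> u \<in> range (res S) \<and> (\<exists>v. inverse_on S u v)"
    if S: "S \<in> sets M" for S u
  proof -
    have "v \<in> range (res S) \<longleftrightarrow> res S v = v" for v
      using res_res[OF S S] by (metis order_refl rangeE rangeI)
    then show ?thesis unfolding Inv_def inverse_on_def by (simp add: Bex_def) 
  qed
  moreover have "act (L0_class M (indicator S)) = res S" for S
    by (simp add: fun_eq_iff smul_def)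
  moreover have "act (L0_class M f) e = smul f e" by (simp add: smul_def)
  moreover have "L0_class M f \<in> E" using assms by (simp add: in_E_def)
  moreover have "(\<forall>p\<in>idempotents M E. P p) \<longleftrightarrow> (\<forall>S\<in>sets M. P (L0_class M (indicator S)))" for P
    using idempotents_iff by auto
  ultimately show ?thesis
    by (simp add: spm_def indicator_eq_zero_iff)
qed

text \<open>Where |f| > nu x, the element f e - x is invertible as a perturbation of f e with ratio
  nu x / |f| < 1. Besides boundedness, the estimate keeps glued functions inside \<open>E\<close> in
  \<open>spm_cyclic\<close>.\<close>

lemma spm_bound:
  assumes f: "in_E f" and spm: "L0_class M f \<in> spm M E act e x"
  shows "AE w in M. cmod (f w) \<le> nu x w"
proof -
  have [measurable]: "f \<in> borel_measurable M" using f by (rule in_E_measurable)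
  \<comment> \<open>The first condition bounds 1/f by m + 1; the second bounds the ratio nu x / |f|
    by 1 - 1/(m + 1), uniformly on the set. The sets exhaust {|f| > nu x}.\<close>
  define S where "S m = {w \<in> space M. 1 \<le> real (Suc m) * cmod (f w) \<and>
      cmod (f w) \<le> real (Suc m) * (cmod (f w) - nu x w)}" for m
  have S: "S m \<in> sets M" for m unfolding S_def by measurable
  have "AE w in M. w \<notin> S m" for m
  proof (rule ccontr)
    assume nonnull: "\<not> (AE w in M. w \<notin> S m)"
    note S = S[of m]
    have S': "in_E (indicator (S m))" using S by auto
    define r where "r = 1 - 1 / real (Suc m)"
    have r: "0 \<le> r" "r < 1" by (auto simp: r_def field_simps)
    define g where "g = (\<lambda>w. indicator (S m) w / f w)"
    have f0: "f w \<noteq> 0" if "w \<in> S m" for w using that by (auto simp: S_def)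
    have g_le: "cmod (g w) \<le> real (Suc m)" for w
      using f0[of w] by (auto simp: g_def indicator_def norm_divide S_def field_simps)
    have g: "in_E g"
    proof (rule in_E_bounded)
      show "g \<in> borel_measurable M" unfolding g_def using S by measurable
    qed (use g_le in auto)
    have gg: "res (S m) (smul g e) = smul g e"
      using S g by (rule res_eq_self) (simp add: g_def)
    have fg: "smul f (smul g e) = res (S m) e"
      unfolding smul_smul[OF f g]
      by (rule smul_cong[OF in_E_mult[OF f g] S']) (use f0 in \<open>auto simp: g_def indicator_def\<close>)
    have "inverse_on (S m) (res (S m) (smul f e)) (smul g e)"
      using gg fg f g S S'
      by (simp add: inverse_on_def smul_mult_left smul_mult_right unit_left unit_right res_res
          smul_commute[of g f] smul_commute[of g "indicator (S m)"])
    moreover have "res (S m) (res (S m) x) = res (S m) x" using S by (simp add: res_res)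
    moreover have "res (S m) x * smul g e = smul g e * res (S m) x"
      using g by (simp add: smul_mult_left smul_mult_right unit_left unit_right)
    moreover have "AE w in M. nu (smul g e * res (S m) x) w \<le> r"
      using nu_smul[OF g, of "res (S m) x"] nu_res[OF S, of x]
    proof eventually_elim
      case (elim w)
      show ?case
      proof (cases "w \<in> S m")
        case True
        then have "cmod (f w) \<le> real (Suc m) * (cmod (f w) - nu x w)" "cmod (f w) > 0"
          using f0 by (auto simp: S_def)
        then have "nu x w / cmod (f w) \<le> r"
          by (simp add: r_def field_simps)
        then show ?thesis
          using elim True g by (simp add: smul_mult_left unit_left g_def norm_divide)
      next
        case False
        then show ?thesis using elim r g by (simp add: smul_mult_left unit_left)
      qed
    qed
    ultimately obtain v' where "inverse_on (S m) (res (S m) (smul f e) - res (S m) x) v'"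
      using inverse_on_perturb[OF S _ _ _ r] by metis
    then have "inverse_on (S m) (res (S m) (smul f e - x)) v'"
      using S' by (simp add: smul_diff_right)
    then show False using spm nonnull S by (auto simp: spm_iff[OF f])
  qed
  then have "AE w in M. \<forall>m. w \<notin> S m" by (simp add: AE_all_countable)
  with AE_space show ?thesis
  proof eventually_elim
    case (elim w)
    show ?case
    proof (rule ccontr)
      assume "\<not> cmod (f w) \<le> nu x w"
      then have *: "cmod (f w) - nu x w > 0" "cmod (f w) > 0"
        using nu_nonneg[of x w] by linarith+
      obtain m where "max (1 / cmod (f w)) (cmod (f w) / (cmod (f w) - nu x w)) < real m"
        using reals_Archimedean2 by blast
      also have "real m < real (Suc m)" by simp
      finally have m: "max (1 / cmod (f w)) (cmod (f w) / (cmod (f w) - nu x w)) < real (Suc m)" .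
      have "1 < real (Suc m) * cmod (f w)"
          "cmod (f w) < real (Suc m) * (cmod (f w) - nu x w)"
        using m * by (simp_all only: max_less_iff_conj pos_divide_less_eq)
      then have "w \<in> S m" using elim(1) unfolding S_def by (blast intro: less_imp_le)
      with elim(2) show False by blast
    qed
  qed
qed

lemma spm_o_bounded: "o_bounded M E (spm M E act e x)"
  unfolding o_bounded_def
proof (intro bexI[of _ "nrm x"] ballI)
  fix a assume a: "a \<in> spm M E act e x"
  then obtain f where f: "in_E f" "a = L0_class M f" using E_cases by (auto simp: spm_def)
  note [measurable] = in_E_measurable[OF f(1)]
  show "L0_le M (L0_abs M a) (nrm x)"
    using spm_bound[of f x] a f
    by (simp add: nrm_eq_nu L0_abs_def L0_lift1_class L0_le_class less_eq_complex_def)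
qed (rule nrm_in)

text \<open>An inverse \<open>v\<close> at the limit may be unbounded. On some nonnull part a member
  of the sequence differs from the limit by at most 1 / (2 (1 + nu v)); the product with nu v is
  then at most 1/2, so an inverse survives for that member, contrary to its membership in the
  spectrum.\<close>

lemma spm_o_closed: "o_closed M E (spm M E act e x)"
  unfolding o_closed_def
proof (intro allI impI)
  fix s :: "nat \<Rightarrow> ('w \<Rightarrow> complex) set" and l
  assume s: "\<forall>n. s n \<in> spm M E act e x" and l: "l \<in> E" and lim: "o_tendsto M E s l sequentially"
  have "\<exists>f. in_E f \<and> s n = L0_class M f" for n
  proof -
    have "s n \<in> E" using s by (simp add: spm_def)
    then show ?thesis by (rule E_cases) blast
  qed
  then obtain f where f: "\<And>n. in_E (f n)" "s = (\<lambda>n. L0_class M (f n))" by metis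
  obtain g where g: "in_E g" "l = L0_class M g" using l E_cases by blast
  show "l \<in> spm M E act e x"
    unfolding g spm_iff[OF g(1)]
  proof (intro ballI impI notI)
    fix S assume S: "S \<in> sets M" "\<not> (AE w in M. w \<notin> S)"
      and "\<exists>v. inverse_on S (res S (smul g e - x)) v"
    then obtain v where v: "inverse_on S (res S (smul g e - x)) v" by blast
    have pos: "2 * (1 + nu v w) > 0" for w by (simp add: add_pos_nonneg)
    obtain T where T: "T \<in> sets M" "T \<subseteq> S" "\<not> (AE w in M. w \<notin> T)"
      and ev: "\<forall>\<^sub>F n in sequentially. AE w in M. w \<in> T \<longrightarrow>
        cmod (f n w - g w) \<le> 1 / (2 * (1 + nu v w))"
      using o_tendsto_small[OF lim[unfolded f g] in_E_measurable[OF f(1)] in_E_measurable[OF g(1)]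
          S, of "\<lambda>w. 1 / (2 * (1 + nu v w))"] pos by auto
    from ev obtain n where n: "AE w in M. w \<in> T \<longrightarrow> cmod (f n w - g w) \<le> 1 / (2 * (1 + nu v w))"
      by (auto simp: eventually_sequentially)
    have "inverse_on T (res T (smul g e - x)) (res T v)"
      using v S(1) T by (intro inverse_on_subset[of S])
    moreover have "AE w in M. w \<in> T \<longrightarrow> cmod (g w - f n w) * nu (res T v) w \<le> 1 / 2"
      using n nu_res[OF T(1), of v]
    proof eventually_elim
      case (elim w)
      show ?case
      proof
        assume w: "w \<in> T"
        have "cmod (g w - f n w) * nu (res T v) w \<le> 1 / (2 * (1 + nu v w)) * nu v w"
          using elim w by (intro mult_mono) (auto simp: norm_minus_commute)
        also have "\<dots> \<le> 1 / 2" using pos[of w] by (simp add: field_simps)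
        finally show "cmod (g w - f n w) * nu (res T v) w \<le> 1 / 2" .
      qed
    qed
    ultimately obtain v' where "inverse_on T (res T (smul (f n) e - x)) v'"
      by (rule inverse_on_perturb_scalar[OF T(1) g(1) f(1)[of n]])
    moreover have "L0_class M (f n) \<in> spm M E act e x" using s by (simp add: f(2))
    ultimately show False using T(1,3) spm_iff[OF f(1)[of n], of x] by blast
  qed
qed

text \<open>Gluing countably many elements of \<open>E\<close> may lead out of \<open>E\<close>.
  Here all of them are dominated by nu x through \<open>spm_bound\<close>, and solidity
  applies.\<close>

lemma spm_cyclic: "cyclic M E (spm M E act e x)"
  unfolding cyclic_def
proof (intro allI impI)
  fix p a :: "nat \<Rightarrow> ('w \<Rightarrow> complex) set"
  assume p: "partition_of_unity M E p" and a: "\<forall>n. a n \<in> spm M E act e x"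
  have "\<exists>f. in_E f \<and> a n = L0_class M f" for n
  proof -
    have "a n \<in> E" using a by (simp add: spm_def)
    then show ?thesis by (rule E_cases) blast
  qed
  then obtain f where f: "\<And>n. in_E (f n)" "\<And>n. a n = L0_class M (f n)" by metis
  note [measurable] = in_E_measurable[OF f(1)]
  have "p n \<in> idempotents M E" for n using p by (simp add: partition_of_unity_def)
  then have "\<exists>S. S \<in> sets M \<and> p n = L0_class M (indicator S)" for n
    using idempotents_iff[of "p n"] by auto
  then obtain S where S [measurable]: "\<And>n. S n \<in> sets M" and pS: "\<And>n. p n = L0_class M (indicator (S n))"
    by metis
  have "AE w in M. \<forall>m n. m \<noteq> n \<longrightarrow> w \<in> S m \<longrightarrow> w \<notin> S n"
    unfolding AE_all_countable
  proof (intro allI)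
    fix m n
    show "AE w in M. m \<noteq> n \<longrightarrow> w \<in> S m \<longrightarrow> w \<notin> S n"
    proof (cases "m = n")
      case False
      then have "L0_mult M (p m) (p n) = L0_zero M" using p by (auto simp: partition_of_unity_def)
      then have "AE w in M. indicator (S m) w * indicator (S n) w = (0::complex)"
        using S by (simp add: pS L0_mult_def L0_lift2_class L0_const_def L0_class_eq_iff)
      then show ?thesis by eventually_elim (auto simp: indicator_def)
    qed simp
  qed
  moreover have "AE w in M. w \<in> (\<Union>n. S n)"
  proof -
    let ?U = "\<Union>n. S n"
    have U: "?U \<in> sets M" by measurable
    have "L0_le M (L0_one M) (L0_class M (indicator ?U))"
    proof -
      have "L0_class M (indicator ?U) \<in> idempotents M E" using U idempotents_iff by blast
      moreover have "L0_le M (p n) (L0_class M (indicator ?U))" for n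
        using S U by (auto simp: pS L0_le_class less_eq_complex_def indicator_def)
      ultimately show ?thesis using p by (auto simp: partition_of_unity_def)
    qed
    then have "AE w in M. 1 \<le> (indicator ?U w :: complex)"
      using U by (simp add: L0_const_def L0_le_class)
    then show ?thesis
    proof eventually_elim
      case (elim w)
      then show ?case by (cases "w \<in> ?U") (auto simp: less_eq_complex_def)
    qed
  qed
  ultimately have SU: "AE w in M. w \<in> (\<Union>n. S n) \<and> (\<forall>m n. m \<noteq> n \<longrightarrow> w \<in> S m \<longrightarrow> w \<notin> S n)"
    by eventually_elim auto
  \<comment> \<open>The index is unique a.e.; on the remaining null set \<open>LEAST\<close> may
    return any index, which is harmless since every f n is measurable and the domination by nu x
    holds for all indices at once.\<close>
  define b where "b w = f (LEAST n. w \<in> S n) w" for w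
  have b_meas [measurable]: "b \<in> borel_measurable M"
    unfolding b_def by measurable
  have b_eq: "AE w in M. \<forall>n. w \<in> S n \<longrightarrow> b w = f n w"
    using SU
  proof eventually_elim
    case (elim w)
    then have "(LEAST n. w \<in> S n) = n" if "w \<in> S n" for n
      using that by (metis LeastI)
    then show ?case by (simp add: b_def)
  qed
  have "AE w in M. \<forall>n. cmod (f n w) \<le> nu x w"
    unfolding AE_all_countable using spm_bound[OF f(1)] a f(2) by simp
  then have "AE w in M. cmod (b w) \<le> cmod (complex_of_real (nu x w))"
    by eventually_elim (simp add: b_def)
  with b_meas in_E_nu have b: "in_E b" by (rule in_E_solid)
  show "\<exists>b\<in>spm M E act e x. is_mixing M p a b"
  proof (rule bexI)
    have "L0_mult M (p n) (L0_class M b) = L0_mult M (p n) (a n)" for n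
    proof -
      have "AE w in M. indicator (S n) w * b w = indicator (S n) w * f n w"
        using b_eq by eventually_elim (auto simp: indicator_def)
      then show ?thesis by (simp add: pS f L0_mult_def L0_lift2_class L0_class_eq_iff)
    qed
    then show "is_mixing M p a (L0_class M b)" by (auto simp: is_mixing_def L0_def)
    show "L0_class M b \<in> spm M E act e x"
      unfolding spm_iff[OF b]
    proof (intro ballI impI notI)
      fix T assume T: "T \<in> sets M" "\<not> (AE w in M. w \<notin> T)"
        and "\<exists>v. inverse_on T (res T (smul b e - x)) v"
      then obtain v where v: "inverse_on T (res T (smul b e - x)) v" by blast
      have "\<exists>n. \<not> (AE w in M. w \<notin> T \<inter> S n)"
      proof (rule ccontr)
        assume "\<nexists>n. \<not> (AE w in M. w \<notin> T \<inter> S n)"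
        then have "AE w in M. \<forall>n. w \<notin> T \<inter> S n"
          unfolding AE_all_countable by simp
        with SU have "AE w in M. w \<notin> T" by eventually_elim auto
        with T(2) show False by simp
      qed
      then obtain n where n: "\<not> (AE w in M. w \<notin> T \<inter> S n)" by blast
      have TS: "T \<inter> S n \<in> sets M" "T \<inter> S n \<subseteq> T" using T S by auto
      have "inverse_on (T \<inter> S n) (res (T \<inter> S n) (smul b e - x)) (res (T \<inter> S n) v)"
        using v T(1) TS by (rule inverse_on_subset)
      moreover have "res (T \<inter> S n) (smul b e) = res (T \<inter> S n) (smul (f n) e)"
        using b_eq TS b f by (intro res_smul_cong) (auto elim: AE_mp)
      ultimately have "inverse_on (T \<inter> S n) (res (T \<inter> S n) (smul (f n) e - x)) (res (T \<inter> S n) v)"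
        using TS by (simp add: smul_diff_right in_E_indicator)
      moreover have "L0_class M (f n) \<in> spm M E act e x" using a by (simp flip: f(2))
      ultimately show False using n TS(1) spm_iff[OF f(1)[of n], of x] by blast
    qed
  qed
qed

section \<open>Existence of spectral elements\<close>

text \<open>The essential supremum of \<open>nu u\<close>, meaningful for bounded elements. The
  condition 0 \<le> C keeps the set bounded below even when the whole space is null.\<close>

definition ess_norm :: "'u \<Rightarrow> real" where
  "ess_norm u = Inf {C. 0 \<le> C \<and> (AE w in M. nu u w \<le> C)}"

lemma ess_norm_le: "0 \<le> C \<Longrightarrow> AE w in M. nu u w \<le> C \<Longrightarrow> ess_norm u \<le> C"
  unfolding ess_norm_def by (rule cInf_lower) (auto intro!: bdd_belowI[of _ 0])

text \<open>The infimum is attained: the bounds \<open>ess_norm u\<close> + 1/(n + 1) hold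
  simultaneously outside a countable union of null sets.\<close>

lemma
  assumes "AE w in M. nu u w \<le> C"
  shows ess_norm_nonneg: "0 \<le> ess_norm u" and nu_le_ess_norm: "AE w in M. nu u w \<le> ess_norm u"
proof -
  let ?X = "{C. 0 \<le> C \<and> (AE w in M. nu u w \<le> C)}"
  have "AE w in M. nu u w \<le> max C 0" using assms by eventually_elim auto
  then have ne: "?X \<noteq> {}" by (auto intro!: exI[of _ "max C 0"])
  then show "0 \<le> ess_norm u" unfolding ess_norm_def by (rule cInf_greatest) auto
  have "AE w in M. nu u w \<le> ess_norm u + 1 / real (Suc n)" for n
  proof -
    have "Inf ?X < ess_norm u + 1 / real (Suc n)" by (simp add: ess_norm_def)
    then obtain B where "B < ess_norm u + 1 / real (Suc n)" "AE w in M. nu u w \<le> B"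
      using cInf_lessD[OF ne] by blast
    then show ?thesis by (auto elim: AE_mp)
  qed
  then have "AE w in M. \<forall>n. nu u w \<le> ess_norm u + 1 / real (Suc n)"
    unfolding AE_all_countable by blast
  then show "AE w in M. nu u w \<le> ess_norm u"
  proof eventually_elim
    case (elim w)
    have "(\<lambda>n. ess_norm u + 1 / real (Suc n)) \<longlonglongrightarrow> ess_norm u + 0"
      using LIMSEQ_inverse_real_of_nat by (intro tendsto_intros) (simp add: inverse_eq_divide)
    then show ?case using elim by (intro LIMSEQ_le_const[of _ "ess_norm u"]) auto
  qed
qed

text \<open>Positive measure of \<open>S\<close> enters through the norm of the unit: the norm of
  \<open>res S e\<close> is the indicator of \<open>S\<close>, with essential supremum 1.\<close>

lemma normed_algebra_on_bounded:
  assumes S: "S \<in> sets M" "\<not> (AE w in M. w \<notin> S)"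
  shows "normed_algebra_on sc {u. res S u = u \<and> (\<exists>C. AE w in M. nu u w \<le> C)} ess_norm (res S e)"
    (is "normed_algebra_on sc ?A _ _")
proof
  have S': "in_E (indicator S)" using S by auto
  have bound: "0 \<le> ess_norm u" "AE w in M. nu u w \<le> ess_norm u" if "u \<in> ?A" for u
    using that ess_norm_nonneg nu_le_ess_norm by blast+
  have e: "AE w in M. nu (res S e) w = indicator S w"
    using nu_res[OF S(1), of e] nu_unit by eventually_elim simp
  have e_le: "AE w in M. nu (res S e) w \<le> 1"
    using e by eventually_elim (simp add: indicator_def)
  show "res S e \<in> ?A" using S e_le by (auto simp: res_res)
  show "ess_norm (res S e) = 1"
  proof (rule antisym)
    show "ess_norm (res S e) \<le> 1" using e_le by (intro ess_norm_le) auto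
    show "1 \<le> ess_norm (res S e)"
    proof (rule ccontr)
      assume *: "\<not> 1 \<le> ess_norm (res S e)"
      have "AE w in M. w \<notin> S"
        using nu_le_ess_norm[OF e_le] e by eventually_elim (use * in auto)
      with S(2) show False by simp
    qed
  qed
  fix u v l
  show "sc l u * v = sc l (u * v)" by (rule sc_mult_left[symmetric])
  show "u * sc l v = sc l (u * v)" by (rule sc_mult_right[symmetric])
  assume u: "u \<in> ?A"
  show "0 \<le> ess_norm u" using u by (rule bound)
  show "res S e * u = u" "u * res S e = u"
    using u S' by (simp_all add: smul_mult_left smul_mult_right unit_left unit_right)
  have scale: "AE w in M. nu (sc l u) w \<le> cmod l * ess_norm u"
    using bound(2)[OF u] nu_scale[of l u] by eventually_elim (simp add: mult_left_mono)
  have "res S (sc l u) = sc l (res S u)"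
    using smul_commute[OF S' in_E_const] by (simp add: smul_const)
  with scale u show "sc l u \<in> ?A" by auto
  show "ess_norm (sc l u) \<le> cmod l * ess_norm u"
    using scale bound(1)[OF u] by (intro ess_norm_le) auto
  assume v: "v \<in> ?A"
  have add: "AE w in M. nu (u + v) w \<le> ess_norm u + ess_norm v"
    using bound(2)[OF u] bound(2)[OF v] nu_add[of u v] by eventually_elim simp
  have mult: "AE w in M. nu (u * v) w \<le> ess_norm u * ess_norm v"
    using bound(2)[OF u] bound(2)[OF v] nu_mult[of u v]
  proof eventually_elim
    case (elim w)
    have "nu u w * nu v w \<le> ess_norm u * ess_norm v"
      using elim bound(1)[OF u] by (intro mult_mono) auto
    with elim show ?case by simp
  qed
  show "u + v \<in> ?A" using u v S' add by (auto simp: smul_add_right)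
  have "res S (u * v) = res S u * v" using S' by (simp add: smul_mult_left)
  then show "u * v \<in> ?A" using u mult by auto
  show "ess_norm (u + v) \<le> ess_norm u + ess_norm v"
    using add bound(1)[OF u] bound(1)[OF v] by (intro ess_norm_le) auto
  show "ess_norm (u * v) \<le> ess_norm u * ess_norm v"
    using mult bound(1)[OF u] bound(1)[OF v] by (intro ess_norm_le) auto
qed

text \<open>The bound \<open>C\<close> may depend on \<xi>, so resolvability for finitely many sets
  of scalars on a common \<open>S\<close> passes to any \<open>Q\<close> that they cover.\<close>

definition resolvable :: "'u \<Rightarrow> complex set \<Rightarrow> 'w set \<Rightarrow> bool" where
  "resolvable x Q S \<longleftrightarrow> S \<in> sets M \<and>
    (\<forall>\<xi>\<in>Q. \<exists>v C. inverse_on S (res S (sc \<xi> e - x)) v \<and> (AE w in M. nu v w \<le> C))"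

lemma resolvable_subset:
  assumes "resolvable x Q S" "T \<in> sets M" "T \<subseteq> S"
  shows "resolvable x Q T"
  unfolding resolvable_def
proof (intro conjI ballI)
  fix \<xi> assume "\<xi> \<in> Q"
  then obtain v C where v: "inverse_on S (res S (sc \<xi> e - x)) v" "AE w in M. nu v w \<le> C"
    using assms by (auto simp: resolvable_def)
  have "AE w in M. nu (res T v) w \<le> C"
    using nu_res[OF assms(2), of v] v(2)
  proof eventually_elim
    case (elim w)
    then show ?case by (cases "w \<in> T") (auto intro: order_trans[OF nu_nonneg])
  qed
  with v assms inverse_on_subset show
    "\<exists>v C. inverse_on T (res T (sc \<xi> e - x)) v \<and> (AE w in M. nu v w \<le> C)"
    unfolding resolvable_def by blast
qed (rule assms)

text \<open>For |\<xi>| > 2 the Neumann series around \<xi> e has ratio at most 1/2 and yields a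
  bounded inverse. Resolvability on the disc would thus provide bounded inverses for every scalar,
  against \<open>spectrum_nonempty\<close>.\<close>

lemma not_resolvable:
  assumes x: "AE w in M. nu x w \<le> 1" and S: "S \<in> sets M" "\<not> (AE w in M. w \<notin> S)"
  shows "\<not> resolvable x (cball 0 2) S"
proof
  assume *: "resolvable x (cball 0 2) S"
  have S': "in_E (indicator S)" using S by auto
  let ?A = "{u. res S u = u \<and> (\<exists>C. AE w in M. nu u w \<le> C)}"
  interpret A: normed_algebra_on sc ?A ess_norm "res S e"
    using S by (rule normed_algebra_on_bounded)
  have nu_res_x: "AE w in M. nu (res S x) w \<le> 1"
    using x nu_res[OF S(1), of x] by eventually_elim (auto simp: indicator_def)
  have res_x: "res S (res S x) = res S x" using S by (simp add: res_res)
  have res_sc: "res S (sc \<xi> u) = sc \<xi> (res S u)" for \<xi> u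
    using smul_commute[OF S' in_E_const] by (simp add: smul_const)
  have eq: "sc \<xi> (res S e) - res S x = res S (sc \<xi> e - x)" for \<xi>
    using S' by (simp add: smul_diff_right res_sc)
  have "\<exists>v C. inverse_on S (res S (sc \<xi> e - x)) v \<and> (AE w in M. nu v w \<le> C)" for \<xi>
  proof (cases "\<xi> \<in> cball 0 2")
    case True
    with * show ?thesis by (simp add: resolvable_def)
  next
    case False
    then have \<xi>: "cmod \<xi> \<ge> 2" "\<xi> \<noteq> 0" by auto
    let ?v = "sc (1 / \<xi>) (res S e)"
    have inv: "inverse_on S (sc \<xi> (res S e)) ?v"
      using \<xi> S by (simp add: inverse_on_def res_sc res_res res_mult unit_left A.scale_mult_left A.scale_mult_right)
    have comm: "res S x * ?v = ?v * res S x"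
      using S by (simp add: A.scale_mult_left A.scale_mult_right res_mult unit_left unit_right)
    have v_x: "?v * res S x = sc (1 / \<xi>) (res S x)"
      using S by (simp add: A.scale_mult_left res_mult unit_left)
    have le: "AE w in M. nu (?v * res S x) w \<le> 1 / 2"
      unfolding v_x using nu_scale[of "1 / \<xi>" "res S x"] nu_res_x
    proof eventually_elim
      case (elim w)
      have "cmod (1 / \<xi>) * nu (res S x) w \<le> 1 / 2 * 1"
        using elim \<xi> by (intro mult_mono) (auto simp: norm_divide field_simps)
      with elim show ?case by simp
    qed
    obtain v' where v': "inverse_on S (sc \<xi> (res S e) - res S x) v'"
      "AE w in M. nu v' w \<le> nu ?v w / (1 - 1 / 2)"
      using inverse_on_perturb[OF S(1) inv res_x comm _ _ le] by auto
    have "AE w in M. nu v' w \<le> 2 * cmod (1 / \<xi>)"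
      using v'(2) nu_scale[of "1 / \<xi>" "res S e"] nu_res[OF S(1), of e] nu_unit
    proof eventually_elim
      case (elim w)
      then show ?case by (cases "w \<in> S") (auto intro: order_trans)
    qed
    with v'(1) show ?thesis unfolding eq by blast
  qed
  then have "\<exists>v\<in>?A. v * (sc \<xi> (res S e) - res S x) = res S e \<and>
      (sc \<xi> (res S e) - res S x) * v = res S e" for \<xi>
    unfolding eq by (fastforce simp: inverse_on_def)
  moreover have "res S x \<in> ?A" using res_x nu_res_x by blast
  ultimately show False using A.spectrum_nonempty by blast
qed

lemma unit_disc_cover:
  obtains c :: "nat \<Rightarrow> complex" and K
  where "\<And>i. cmod (c i) \<le> 1" "\<And>z. cmod z \<le> 1 \<Longrightarrow> \<exists>i<K. cmod (z - c i) \<le> 1 / 2"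
proof -
  have "seq_compact (cball (0::complex) 1)" by (simp add: seq_compact_eq_compact)
  then obtain k where k: "finite k" "k \<subseteq> cball 0 1" "cball (0::complex) 1 \<subseteq> (\<Union>y\<in>k. ball y (1/2))"
    using seq_compact_imp_totally_bounded[of "cball (0::complex) 1"] by (metis half_gt_zero_iff zero_less_one)
  obtain n and f :: "nat \<Rightarrow> complex" where f: "k = f ` {i. i < n}"
    using finite_imp_nat_seg_image_inj_on[OF k(1)] by blast
  \<comment> \<open>The default 0 keeps |c i| \<le> 1 for every index, including those that a later
    \<open>LEAST\<close> may return where no index is suitable.\<close>
  define c where "c i = (if i < n then f i else 0)" for i
  show thesis
  proof (rule that[of c n])
    show "cmod (c i) \<le> 1" for i using k(2) f by (auto simp: c_def)
    fix z :: complex assume "cmod z \<le> 1"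
    then have "z \<in> (\<Union>y\<in>k. ball y (1/2))" using subsetD[OF k(3), of z] by simp
    then obtain i where "i < n" "cmod (z - f i) < 1 / 2"
      by (auto simp: f dist_norm norm_minus_commute)
    then show "\<exists>i<n. cmod (z - c i) \<le> 1 / 2" by (auto simp: c_def intro!: exI[of _ i])
  qed
qed

text \<open>A list records the chosen discs, newest first. Up to null sets, \<open>s l\<close> is
  the largest set on no nonnull part of which the disc of \<open>l\<close> is resolvable, and a.e.
  point \<open>w\<close> lies in \<open>s (p n w)\<close> for all \<open>n\<close>.\<close>

lemma spm_nonempty_bounded:
  assumes x: "AE w in M. nu x w \<le> 1"
  shows "\<exists>a. in_E a \<and> L0_class M a \<in> spm M E act e x"
proof -
  obtain c :: "nat \<Rightarrow> complex" and K where c: "\<And>i. cmod (c i) \<le> 1"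
    and cover: "\<And>z. cmod z \<le> 1 \<Longrightarrow> \<exists>i<K. cmod (z - c i) \<le> 1 / 2"
    using unit_disc_cover by blast
  define rad :: "nat list \<Rightarrow> real" where "rad l = 2 * (1/2) ^ length l" for l
  \<comment> \<open>The unit disc cover is scaled to the current disc: the new centre lies in the
    old disc, and the halved discs with i < K cover it.\<close>
  define ctr where "ctr = rec_list (0::complex) (\<lambda>i l z. z + of_real (rad l) * c i)"
  have ctr_simps: "ctr [] = 0" "ctr (i # l) = ctr l + of_real (rad l) * c i" for i l
    by (simp_all add: ctr_def)
  have rad: "rad l > 0" "rad (i # l) = rad l / 2" for i l by (simp_all add: rad_def)
  have disc_cover: "\<exists>i<K. z \<in> cball (ctr (i # l)) (rad (i # l))" if "z \<in> cball (ctr l) (rad l)" for z l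
  proof -
    let ?z = "(z - ctr l) / of_real (rad l)"
    have "cmod ?z \<le> 1"
      using that rad(1)[of l] by (simp add: norm_divide dist_norm norm_minus_commute)
    then obtain i where i: "i < K" "cmod (?z - c i) \<le> 1 / 2" using cover by blast
    have "of_real (rad l) * ?z = z - ctr l" using rad(1)[of l] by simp
    then have "of_real (rad l) * (?z - c i) = z - ctr (i # l)"
      by (simp only: right_diff_distrib[of _ ?z] ctr_simps diff_diff_eq)
    then have "cmod (z - ctr (i # l)) = cmod (of_real (rad l) * (?z - c i))"
      by simp
    also have "\<dots> = rad l * cmod (?z - c i)" using rad(1)[of l] by (simp add: norm_mult)
    also have "\<dots> \<le> rad l * (1 / 2)" using i rad(1)[of l] by (intro mult_left_mono) auto
    finally show ?thesis using i by (auto simp: rad dist_norm norm_minus_commute)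
  qed
  define P where "P l = resolvable x (cball (ctr l) (rad l))" for l
  have P: "S \<in> sets M" if "P l S" for l S using that by (simp add: P_def resolvable_def)
  have P_subset: "P l S \<Longrightarrow> T \<in> sets M \<Longrightarrow> T \<subseteq> S \<Longrightarrow> P l T" for l S T
    unfolding P_def by (rule resolvable_subset)
  \<comment> \<open>Supplies the member that the exhaustion needs to start: on the empty set the
    local unit is 0 and 0 is its own inverse.\<close>
  have P_empty: "P l {}" for l
  proof -
    have "u = 0" if "AE w in M. nu u w = indicator {} w * nu v w" for u v
      using that nu_eq_0_iff[of u] by simp
    then have "res {} u = 0" for u using nu_res[of "{}" u] by blast
    then show ?thesis using nu_zero
      by (auto simp: P_def resolvable_def inverse_on_def intro!: exI[of _ 0] elim: AE_mp)
  qed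
  have "\<exists>A :: nat \<Rightarrow> 'w set. (\<forall>n. P l (A n)) \<and> (\<forall>S. P l S \<longrightarrow> (AE w in M. w \<in> S \<longrightarrow> w \<in> (\<Union>n. A n)))" for l
    by (rule countable_essential_cover[of "P l", OF P P_empty]) blast+
  then obtain A :: "nat list \<Rightarrow> nat \<Rightarrow> 'w set" where A: "\<And>l n. P l (A l n)"
    and A_cover: "\<And>l S. P l S \<Longrightarrow> AE w in M. w \<in> S \<longrightarrow> w \<in> (\<Union>n. A l n)"
    by metis
  define s where "s l = space M - (\<Union>n. A l n)" for l
  have A_sets [measurable]: "A l n \<in> sets M" for l n using A P by blast
  have s_sets [measurable]: "s l \<in> sets M" for l unfolding s_def by measurable
  have not_P: "AE w in M. w \<notin> S" if "P l S" "S \<subseteq> s l" for S l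
    using A_cover[OF that(1)] by eventually_elim (use that(2) in \<open>auto simp: s_def\<close>)
  \<comment> \<open>The union of the \<open>A l n\<close> may fail to be resolvable, as the bounds
    on the pieces can grow; but a nonnull set off \<open>s l\<close> meets one single piece in a
    nonnull set.\<close>
  have ex_P: "\<exists>S. P l S \<and> S \<subseteq> T \<and> \<not> (AE w in M. w \<notin> S)"
    if T: "T \<in> sets M" "T \<inter> s l = {}" "\<not> (AE w in M. w \<notin> T)" for T l
  proof -
    have "\<exists>n. \<not> (AE w in M. w \<notin> T \<inter> A l n)"
    proof (rule ccontr)
      assume "\<nexists>n. \<not> (AE w in M. w \<notin> T \<inter> A l n)"
      then have "AE w in M. \<forall>n. w \<notin> T \<inter> A l n" unfolding AE_all_countable by simp
      with AE_space have "AE w in M. w \<notin> T"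
        by eventually_elim (use T(2) in \<open>auto simp: s_def\<close>)
      with T(3) show False by simp
    qed
    then obtain n where n: "\<not> (AE w in M. w \<notin> T \<inter> A l n)" by blast
    moreover have "P l (T \<inter> A l n)" using T by (intro P_subset[OF A[of l n]]) auto
    ultimately show ?thesis by blast
  qed
  have s_Nil: "AE w in M. w \<in> s []"
  proof (rule ccontr)
    assume not: "\<not> (AE w in M. w \<in> s [])"
    have "\<not> (AE w in M. w \<notin> space M - s [])"
    proof
      assume "AE w in M. w \<notin> space M - s []"
      with AE_space have "AE w in M. w \<in> s []" by eventually_elim auto
      with not show False by simp
    qed
    then obtain S where "P [] S" "\<not> (AE w in M. w \<notin> S)"
      using ex_P[of "space M - s []" "[]"] by auto
    then show False using not_resolvable[OF x P, of "[]" S] by (simp add: P_def ctr_simps rad_def)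
  qed
  have s_Cons: "AE w in M. w \<in> s l \<longrightarrow> (\<exists>i. w \<in> s (i # l))" for l
  proof (rule ccontr)
    \<comment> \<open>These points are lost by all K smaller discs. If they were nonnull, one
      shrinking for each i < K would leave a nonnull part on which all smaller discs, and hence the
      disc of \<open>l\<close>, are resolvable.\<close>
    define T where "T = s l - (\<Union>i<K. s (i # l))"
    have T: "T \<in> sets M" unfolding T_def by measurable
    assume not: "\<not> (AE w in M. w \<in> s l \<longrightarrow> (\<exists>i. w \<in> s (i # l)))"
    have T_nonnull: "\<not> (AE w in M. w \<notin> T)"
    proof
      assume "AE w in M. w \<notin> T"
      then have "AE w in M. w \<in> s l \<longrightarrow> (\<exists>i. w \<in> s (i # l))" by eventually_elim (auto simp: T_def)
      with not show False by simp
    qed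
    have "\<exists>S\<subseteq>T. S \<in> sets M \<and> \<not> (AE w in M. w \<notin> S) \<and> (\<forall>i<j. P (i # l) S)" if "j \<le> K" for j
      using that
    proof (induction j)
      case 0
      show ?case using T T_nonnull by auto
    next
      case (Suc j)
      then obtain S where S: "S \<subseteq> T" "S \<in> sets M" "\<not> (AE w in M. w \<notin> S)" "\<forall>i<j. P (i # l) S"
        by auto
      have "S \<inter> s (j # l) = {}" using S(1) Suc.prems by (auto simp: T_def)
      then obtain S' where S': "P (j # l) S'" "S' \<subseteq> S" "\<not> (AE w in M. w \<notin> S')"
        using ex_P[OF S(2) _ S(3)] by blast
      moreover have "P (i # l) S'" if "i < j" for i
        using P_subset[of "i # l" S S'] S S' P that by blast
      ultimately show ?case using S(1) P by (intro exI[of _ S']) (auto simp: less_Suc_eq)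
    qed
    then obtain S where S: "S \<subseteq> T" "S \<in> sets M" "\<not> (AE w in M. w \<notin> S)" "\<forall>i<K. P (i # l) S"
      by blast
    have "P l S"
      using S(2,4) disc_cover unfolding P_def resolvable_def by blast
    moreover have "S \<subseteq> s l" using S(1) by (auto simp: T_def)
    ultimately show False using not_P S(3) by blast
  qed
  \<comment> \<open>\<open>LEAST\<close> makes the choice of the next disc canonical and so
    measurable.\<close>
  define p where "p = rec_nat (\<lambda>_. []) (\<lambda>_ q w. (LEAST i. w \<in> s (i # q w)) # q w)"
  have p_simps: "p 0 w = []" "p (Suc n) w = (LEAST i. w \<in> s (i # p n w)) # p n w" for n w
    by (simp_all add: p_def)
  have p_length: "length (p n w) = n" for n w by (induction n) (simp_all add: p_simps)
  have p_measurable [measurable]: "p n \<in> measurable M (count_space UNIV)" for n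
  proof (induction n)
    case 0
    then show ?case by (simp add: p_def)
  next
    case (Suc n)
    have F: "(\<lambda>w. (LEAST i. w \<in> s (i # l)) # l) \<in> measurable M (count_space UNIV)" for l
    proof -
      have [measurable]: "(\<lambda>w. LEAST i. w \<in> s (i # l)) \<in> measurable M (count_space UNIV)"
        by measurable
      show ?thesis
        by (rule measurable_compose[where g = "\<lambda>i. i # l" and N = "count_space UNIV"]) auto
    qed
    \<comment> \<open>Lists of naturals are countable, so measurability for each fixed list
      suffices.\<close>
    have "(\<lambda>w. (\<lambda>l w. (LEAST i. w \<in> s (i # l)) # l) (p n w) w) \<in> measurable M (count_space UNIV)"
      by (rule measurable_compose_countable[OF F Suc])
    then show ?case by (simp add: p_simps[abs_def])
  qed
  have p_in: "AE w in M. \<forall>n. w \<in> s (p n w)"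
  proof -
    have "AE w in M. \<forall>l. w \<in> s l \<longrightarrow> (\<exists>i. w \<in> s (i # l))"
      unfolding AE_all_countable using s_Cons by blast
    with s_Nil show ?thesis
    proof eventually_elim
      case (elim w)
      have "w \<in> s (p n w)" for n
      proof (induction n)
        case (Suc n)
        then show ?case using elim(2) LeastI_ex[of "\<lambda>i. w \<in> s (i # p n w)"] by (simp add: p_simps)
      qed (use elim in \<open>simp add: p_simps\<close>)
      then show ?case by blast
    qed
  qed
  define z where "z n w = ctr (p n w)" for n w
  have z_measurable [measurable]: "z n \<in> borel_measurable M" for n
    unfolding z_def by (rule measurable_compose[OF p_measurable]) simp
  \<comment> \<open>The centre moves by at most 2 (1/2)^(n+k) at level n + k; the closed form of the
    geometric sum is what the induction reproduces. It holds at every point, so the limit exists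
    everywhere.\<close>
  have z_diff: "cmod (z (n + k) w - z n w) \<le> 4 * (1/2) ^ n - 4 * (1/2) ^ (n + k)" for n k w
  proof (induction k)
    case (Suc k)
    have "cmod (z (n + Suc k) w - z (n + k) w) \<le> 2 * (1/2) ^ (n + k)"
      using c by (simp add: z_def p_simps ctr_simps norm_mult norm_power norm_divide rad_def
          p_length mult_left_le)
    moreover have "cmod (z (n + Suc k) w - z n w) \<le>
        cmod (z (n + Suc k) w - z (n + k) w) + cmod (z (n + k) w - z n w)"
      by norm
    moreover have "(1/2::real) ^ (n + Suc k) = (1/2) ^ (n + k) / 2" by simp
    ultimately show ?case using Suc by linarith
  qed simp
  have "Cauchy (\<lambda>n. z n w)" for w
  proof (rule metric_CauchyI)
    fix \<epsilon> :: real assume "\<epsilon> > 0"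
    then obtain N where N: "(1/2) ^ N < \<epsilon> / 8" using real_arch_pow_inv[of "\<epsilon> / 8" "1/2"] by auto
    have "cmod (z n w - z N w) < \<epsilon> / 2" if "n \<ge> N" for n
    proof -
      have "(0::real) \<le> (1/2) ^ n" by simp
      moreover have "cmod (z n w - z N w) \<le> 4 * (1/2) ^ N - 4 * (1/2) ^ n"
        using z_diff[of N "n - N" w] that by simp
      ultimately show ?thesis using N by linarith
    qed
    then show "\<exists>N. \<forall>m\<ge>N. \<forall>n\<ge>N. dist (z m w) (z n w) < \<epsilon>"
      by (intro exI[of _ N]) (metis dist_norm dist_triangle_half_l dist_commute)
  qed
  then have "convergent (\<lambda>n. z n w)" for w by (rule Cauchy_convergent)
  define a where "a w = lim (\<lambda>n. z n w)" for w
  have z_lim: "(\<lambda>n. z n w) \<longlonglongrightarrow> a w" for w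
    unfolding a_def using \<open>convergent (\<lambda>n. z n w)\<close> by (simp add: convergent_LIMSEQ_iff)
  have a_measurable [measurable]: "a \<in> borel_measurable M"
    by (rule borel_measurable_LIMSEQ_metric[OF z_measurable z_lim])
  have a_z: "cmod (a w - z n w) \<le> 4 * (1/2) ^ n" for n w
  proof (rule LIMSEQ_le_const2)
    show "(\<lambda>k. cmod (z (k + n) w - z n w)) \<longlonglongrightarrow> cmod (a w - z n w)"
      by (intro tendsto_intros LIMSEQ_ignore_initial_segment z_lim)
    have "cmod (z (k + n) w - z n w) \<le> 4 * (1/2) ^ n" for k
    proof -
      have "(0::real) \<le> (1/2) ^ (n + k)" by simp
      then show ?thesis using z_diff[of n k w] unfolding add.commute[of k n] by linarith
    qed
    then show "\<exists>N. \<forall>k\<ge>N. cmod (z (k + n) w - z n w) \<le> 4 * (1/2) ^ n" by blast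
  qed
  have a: "in_E a"
  proof (rule in_E_bounded)
    show "AE w in M. cmod (a w) \<le> 4" using a_z[of _ 0] by (simp add: z_def p_simps ctr_simps)
  qed simp
  moreover have "L0_class M a \<in> spm M E act e x"
    unfolding spm_iff[OF a]
  proof (intro ballI impI notI)
    fix S assume S: "S \<in> sets M" "\<not> (AE w in M. w \<notin> S)"
      and "\<exists>v. inverse_on S (res S (smul a e - x)) v"
    then obtain v where v: "inverse_on S (res S (smul a e - x)) v" by blast
    note [measurable] = S(1)
    \<comment> \<open>\<open>v\<close> may be unbounded, but its sublevel sets exhaust
      \<open>S\<close>, so one of them is nonnull.\<close>
    define B where "B m = {w \<in> space M. w \<in> S \<and> nu v w \<le> real m}" for m
    have B [measurable]: "B m \<in> sets M" for m unfolding B_def by measurable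
    have "\<exists>m. \<not> (AE w in M. w \<notin> B m)"
    proof (rule ccontr)
      assume "\<nexists>m. \<not> (AE w in M. w \<notin> B m)"
      then have "AE w in M. \<forall>m. w \<notin> B m" unfolding AE_all_countable by simp
      with AE_space have "AE w in M. w \<notin> S"
      proof eventually_elim
        case (elim w)
        obtain m where "nu v w \<le> real m" using real_arch_simple by blast
        with elim show ?case by (auto simp: B_def)
      qed
      with S(2) show False by simp
    qed
    then obtain m where m: "\<not> (AE w in M. w \<notin> B m)" by blast
    \<comment> \<open>For \<xi> in the disc at level n, |a - \<xi>| \<le> 4 (1/2)^n + 2 (1/2)^n:
      distance from the limit to the centre plus radius. The factor 12 (m + 1) brings the product
      with the bound m below 1/2.\<close>
    obtain n where n: "(1/2) ^ n < 1 / (12 * (real m + 1))"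
      using real_arch_pow_inv[of "1 / (12 * (real m + 1))" "1/2"] by auto
    \<comment> \<open>Only countably many lists occur, so \<open>p n\<close> is constant on a
      nonnull part; the contradiction is that its disc is resolvable there.\<close>
    have "\<exists>l. \<not> (AE w in M. w \<notin> {w \<in> B m. p n w = l})"
    proof (rule ccontr)
      assume "\<nexists>l. \<not> (AE w in M. w \<notin> {w \<in> B m. p n w = l})"
      then have "AE w in M. \<forall>l. w \<notin> {w \<in> B m. p n w = l}" unfolding AE_all_countable by simp
      then have "AE w in M. w \<notin> B m" by eventually_elim auto
      with m show False by simp
    qed
    then obtain l where l: "\<not> (AE w in M. w \<notin> {w \<in> B m. p n w = l})" by blast
    define T where "T = {w \<in> space M. w \<in> B m \<and> p n w = l \<and> w \<in> s l}"
    have T: "T \<in> sets M" unfolding T_def by measurable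
    have T_sub: "T \<subseteq> S" "T \<subseteq> s l" by (auto simp: T_def B_def)
    have T_nonnull: "\<not> (AE w in M. w \<notin> T)"
    proof
      assume "AE w in M. w \<notin> T"
      with AE_space p_in have "AE w in M. w \<notin> {w \<in> B m. p n w = l}"
        by eventually_elim (auto simp: T_def)
      with l show False by simp
    qed
    have length: "length l = n"
    proof -
      have "T \<noteq> {}" using T_nonnull by auto
      then show ?thesis using p_length by (auto simp: T_def)
    qed
    have v_T: "inverse_on T (res T (smul a e - x)) (res T v)"
      using v S(1) T T_sub(1) by (rule inverse_on_subset)
    have nu_T: "AE w in M. nu (res T v) w \<le> real m"
      using nu_res[OF T, of v] by eventually_elim (auto simp: T_def B_def indicator_def)
    have "P l T"
      unfolding P_def resolvable_def
    proof (intro conjI ballI)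
      fix \<xi> assume \<xi>: "\<xi> \<in> cball (ctr l) (rad l)"
      have "AE w in M. w \<in> T \<longrightarrow> cmod (a w - \<xi>) * nu (res T v) w \<le> 1 / 2"
        using nu_T
      proof eventually_elim
        case (elim w)
        show ?case
        proof
          assume w: "w \<in> T"
          have "cmod (a w - \<xi>) \<le> cmod (a w - z n w) + cmod (z n w - \<xi>)"
            by norm
          also have "\<dots> \<le> 6 * (1/2) ^ n"
            using a_z[of w n] \<xi> w length by (simp add: z_def T_def rad_def dist_norm)
          also have "\<dots> \<le> 6 * (1 / (12 * (real m + 1)))" using n by linarith
          finally have "cmod (a w - \<xi>) * nu (res T v) w \<le> 6 * (1 / (12 * (real m + 1))) * real m"
            using elim by (intro mult_mono) auto
          also have "\<dots> \<le> 1 / 2" by (simp add: field_simps)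
          finally show "cmod (a w - \<xi>) * nu (res T v) w \<le> 1 / 2" .
        qed
      qed
      then obtain v' where v': "inverse_on T (res T (smul (\<lambda>_. \<xi>) e - x)) v'"
          "AE w in M. nu v' w \<le> 2 * nu (res T v) w"
        by (rule inverse_on_perturb_scalar[OF T a in_E_const v_T])
      have "AE w in M. nu v' w \<le> 2 * real m"
        using v'(2) nu_T by eventually_elim simp
      with v'(1) show "\<exists>v C. inverse_on T (res T (sc \<xi> e - x)) v \<and> (AE w in M. nu v w \<le> C)"
        by (auto simp: smul_const)
    qed (rule T)
    then show False using not_P T_sub(2) T_nonnull by blast
  qed
  ultimately show ?thesis by blast
qed

text \<open>Multiplication by \<open>h\<close> undoes that by \<open>g\<close>: if \<open>v\<close>
  inverts (h a) e - x on a set, then \<open>smul h v\<close> inverts a e - g x there.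
  \<open>g\<close> is bounded by 1, and \<open>h\<close> is in \<open>E\<close> because the norm of
  x is.\<close>

lemma spm_nonempty: "spm M E act e x \<noteq> {}"
proof -
  define g where "g w = complex_of_real (1 / (1 + nu x w))" for w
  define h where "h w = complex_of_real (1 + nu x w)" for w
  have pos: "1 + nu x w > 0" for w by (simp add: add_pos_nonneg)
  have norm_g: "cmod (g w) = 1 / (1 + nu x w)" for w
    unfolding g_def norm_of_real using pos[of w] by simp
  have g: "in_E g"
  proof (rule in_E_bounded)
    show "g \<in> borel_measurable M" unfolding g_def by measurable
    have "cmod (g w) \<le> 1" for w using pos[of w] by (simp add: norm_g)
    then show "AE w in M. cmod (g w) \<le> 1" by simp
  qed
  have h: "in_E h" using in_E_add[OF in_E_const[of 1] in_E_nu[of x]] by (simp add: h_def[abs_def])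
  have gh: "g w * h w = 1" for w
    unfolding g_def h_def of_real_mult[symmetric] using pos[of w] by simp
  have "AE w in M. nu (smul g x) w \<le> 1"
    using nu_smul[OF g, of x]
  proof eventually_elim
    case (elim w)
    then show ?case using pos[of w] by (simp add: norm_g)
  qed
  then obtain a where a: "in_E a" and spm: "L0_class M a \<in> spm M E act e (smul g x)"
    using spm_nonempty_bounded by blast
  have ha: "in_E (\<lambda>w. h w * a w)" using h a by auto
  have gh_id: "smul g (smul h u) = u" "smul h (smul g u) = u" for u
    using g h gh by (simp_all add: smul_smul smul_const mult.commute)
  have "L0_class M (\<lambda>w. h w * a w) \<in> spm M E act e x"
    unfolding spm_iff[OF ha]
  proof (intro ballI impI notI)
    fix S assume S: "S \<in> sets M" "\<not> (AE w in M. w \<notin> S)"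
      and "\<exists>v. inverse_on S (res S (smul (\<lambda>w. h w * a w) e - x)) v"
    then obtain v where v: "inverse_on S (res S (smul (\<lambda>w. h w * a w) e - x)) v" by blast
    have S': "in_E (indicator S)" using S by auto
    have "smul g (smul (\<lambda>w. h w * a w) e) = smul a e"
      using gh_id(1)[of "smul a e"] h a by (simp add: smul_smul)
    then have "res S (smul a e - smul g x) = smul g (res S (smul (\<lambda>w. h w * a w) e - x))"
      using g S' by (simp add: smul_commute[of g "indicator S"] smul_diff_right)
    then have "inverse_on S (res S (smul a e - smul g x)) (smul h v)"
      using v g h S'
      by (simp add: inverse_on_def smul_mult_left smul_mult_right gh_id smul_commute[of "indicator S" h])
    then show False using spm S unfolding spm_iff[OF a] by blast
  qed
  then show ?thesis by blast
qed

end

theorem theorem2p5: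
  fixes M :: "'w measure" and E :: "('w \<Rightarrow> complex) set set"
    and sc :: "complex \<Rightarrow> 'u::ring \<Rightarrow> 'u" and nrm :: "'u \<Rightarrow> ('w \<Rightarrow> complex) set"
    and act :: "('w \<Rightarrow> complex) set \<Rightarrow> 'u \<Rightarrow> 'u" and e x :: 'u
  assumes "finite_measure M"
    and "faithful_solid_subalgebra M E"
    and "unital_Banach_Kantorovich_algebra M E sc nrm act e"
  shows "spm M E act e x \<subseteq> E \<and> spm M E act e x \<noteq> {} \<and> o_closed M E (spm M E act e x) \<and>
    cyclic M E (spm M E act e x) \<and> o_bounded M E (spm M E act e x)"
proof -
  interpret finite_BK_algebra M E sc nrm act e
    using assms by (intro finite_BK_algebra.intro)
  have "spm M E act e x \<subseteq> E" by (auto simp: spm_def)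
  then show ?thesis
    using spm_nonempty spm_o_closed spm_cyclic spm_o_bounded by blast
qed

end
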